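(* Consider a transitive long-range percolation model $(V,\mu)$ and $o\in V$, and let $p_m,f_m$ ($m\ge 1$) denote the entire extensions of $t\mapsto\Pr_t(|C(o)|=m)$ and $t\mapsto\Pr_t(|C(o)|\ge m)$ respectively. Define $$t_1:=\inf\{r<0 : \lim_{m\to\infty}p_m(r)=0\},\qquad t_2:=\inf\Big\{r<0 : \sum_{m=1}^\infty m|p_m(r)|<\infty\Big\},$$ $$t_3:=\inf\{r<0 : \lim_{m\to\infty}f_m(r)=0\},\qquad t_4:=\inf\Big\{r<0 : \sum_{m=1}^\infty |f_m(r)|<\infty\Big\},$$ $$t_5:=\inf\{r<0 : \exists\, c<1 \text{ such that } |p_m(r)|\le c^m \text{ for all sufficiently large } m\in\mathbb{N}\}.$$ Then $t_1=t_2=t_3=t_4=t_5$.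
   Context: Long-range model: $V$ is a countably infinite set and $\mu$ is a non-negative function on the set of (unordered) pairs $xy$ of elements of $V$ satisfying $\sum_{y\in V}\mu(xy)=1$ for every $x\in V$. For $t\in[0,\infty)$, $\Pr_t$ is the law of the random graph on $V$ in which each pair $xy$ is independently vacant (a non-edge) with probability $e^{-t\mu(xy)}$ and occupied (an edge) otherwise. $C(o)$ is the connected component of $o$ in this random graph and $|C(o)|$ its number of vertices. The model is transitive if there is a group acting transitively on $V$ and preserving $\mu$. The functions $\Pr_t(|C(o)|=m)$ and $\Pr_t(|C(o)|\ge m)$ of $t\ge 0$ admit unique entire extensions to $\mathbb{C}$. The infima are taken in $\mathbb{R}\cup\{-\infty\}$. *)

theory Defs
  imports
    "HOL-Probability.Probability"
    "HOL-Complex_Analysis.Complex_Analysis"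
    "HOL-Library.Uprod"
    "HOL-Algebra.Group_Action"
begin

text \<open>
  The vertex set is the whole type \<open>'v\<close>. The type \<open>'v uprod\<close> of unordered pairs contains
  the diagonal pairs \<open>Upair x x\<close>. As no assumption forces \<open>\<mu>\<close> to vanish on them, the models
  without loops are the special case \<open>\<mu> (Upair x x) = 0\<close>.
\<close>

locale long_range_model =
  fixes \<mu> :: "'v uprod \<Rightarrow> real"
  assumes countable_V: "countable (UNIV :: 'v set)"
    and infinite_V: "infinite (UNIV :: 'v set)"
    and nonneg: "0 \<le> \<mu> e"
    and total_mass: "((\<lambda>y. \<mu> (Upair x y)) has_sum 1) UNIV"

locale transitive_long_range_model =
  long_range_model \<mu> + transitive_action G UNIV \<phi>
  for \<mu> :: "'v uprod \<Rightarrow> real"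
    and G (structure)
    and \<phi> +
  assumes invariant: "g \<in> carrier G \<Longrightarrow> \<mu> (Upair (\<phi> g x) (\<phi> g y)) = \<mu> (Upair x y)"

text \<open>
  A configuration maps every pair to \<open>True\<close> (occupied) or \<open>False\<close> (vacant).
\<close>

definition perc :: "('v uprod \<Rightarrow> real) \<Rightarrow> real \<Rightarrow> ('v uprod \<Rightarrow> bool) measure"
  where "perc \<mu> t = (\<Pi>\<^sub>M e\<in>UNIV. measure_pmf (bernoulli_pmf (1 - exp (- t * \<mu> e))))"

definition cluster :: "('v uprod \<Rightarrow> bool) \<Rightarrow> 'v \<Rightarrow> 'v set"
  where "cluster \<omega> v = {w. (\<lambda>x y. \<omega> (Upair x y))\<^sup>*\<^sup>* v w}"

text \<open>
  Clusters may be infinite, and \<open>card\<close> is \<open>0\<close> on infinite sets, hence the explicit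
  finiteness conditions.
\<close>

definition prob_cluster_eq :: "('v uprod \<Rightarrow> real) \<Rightarrow> 'v \<Rightarrow> nat \<Rightarrow> real \<Rightarrow> real"
  where "prob_cluster_eq \<mu> v m t =
    measure (perc \<mu> t)
      {\<omega> \<in> space (perc \<mu> t). finite (cluster \<omega> v) \<and> card (cluster \<omega> v) = m}"

definition prob_cluster_ge :: "('v uprod \<Rightarrow> real) \<Rightarrow> 'v \<Rightarrow> nat \<Rightarrow> real \<Rightarrow> real"
  where "prob_cluster_ge \<mu> v m t =
    measure (perc \<mu> t)
      {\<omega> \<in> space (perc \<mu> t). infinite (cluster \<omega> v) \<or> m \<le> card (cluster \<omega> v)}"

definition entire_extension :: "(complex \<Rightarrow> complex) \<Rightarrow> (real \<Rightarrow> real) \<Rightarrow> bool"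
  where "entire_extension g h \<longleftrightarrow>
    g holomorphic_on UNIV \<and> (\<forall>t\<ge>0. g (complex_of_real t) = complex_of_real (h t))"

end

theory Submission
  imports Defs
begin

text \<open>
  For a finite set \<open>S\<close> containing \<open>o\<close>, \<open>Pr\<^sub>t(C(o) = S)\<close> is the probability that \<open>S\<close> is internally
  connected times \<open>exp (- t b)\<close>, where \<open>b\<close> is the mass of the boundary pairs. The first factor is
  a reliability polynomial. Deletion-contraction shows that at \<open>t = - s < 0\<close> it is,
  up to the sign \<open>(- 1)^(|S| - 1)\<close>, a sum without cancellations of products of
  \<open>|S| - 1\<close> factors \<open>exp (s \<mu> e) - 1\<close> with exponentials of nonnegative multiples of \<open>s\<close>. As
  \<open>exp (a x) - 1 \<le> (a / s) (exp (s x) - 1)\<close> for \<open>0 \<le> a \<le> s\<close>, it follows that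
  \<open>|p\<^sub>m(z)| \<le> (|z| / s)^(m - 1) |p\<^sub>m(- s)|\<close> for \<open>|z| \<le> s\<close>. So boundedness of
  \<open>p\<^sub>m(- s)\<close> in \<open>m\<close> already forces exponential decay of \<open>p\<^sub>m\<close> in the open disc of radius \<open>s\<close>, where
  \<open>\<Sum>p\<^sub>m\<close> is therefore analytic. This sum equals \<open>1\<close> for small \<open>t > 0\<close>, because the same
  comparison with time \<open>1\<close> gives \<open>Pr\<^sub>t(|C(o)| \<ge> m) \<le> t^(m - 1) exp ((t + 1) m)\<close>. Hence it
  equals \<open>1\<close> on the whole disc, \<open>f\<^sub>m\<close> is a tail of the series, and \<open>f\<^sub>m\<close> decays exponentially too.
\<close>

section \<open>Connectivity sums and deletion-contraction\<close>

text \<open>Connectivity is phrased through cuts: no proper nonempty part of \<open>R\<close> is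
  closed under the edges of \<open>F\<close>. Edges are labels with a set of endpoints, so that
  contraction only changes \<open>ends\<close> and parallel edges stay distinct.\<close>

definition connects :: "'a set \<Rightarrow> ('e \<Rightarrow> 'a set) \<Rightarrow> 'e set \<Rightarrow> bool"
  where "connects R ends F \<longleftrightarrow>
    (\<forall>U\<subseteq>R. (\<forall>e\<in>F. ends e \<subseteq> U \<or> ends e \<inter> U = {}) \<longrightarrow> U = {} \<or> U = R)"

text \<open>For \<open>y = 1 - x\<close> this is the reliability polynomial of the graph. Values in
  a commutative ring allow it to be evaluated at negative and complex times, where the weights are
  no longer probabilities.\<close>

definition conn_sum ::
  "'a set \<Rightarrow> ('e \<Rightarrow> 'a set) \<Rightarrow> 'e set \<Rightarrow> ('e \<Rightarrow> 'r) \<Rightarrow> ('e \<Rightarrow> 'r) \<Rightarrow> 'r::comm_ring_1"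
  where "conn_sum R ends E x y =
    (\<Sum>F | F \<subseteq> E \<and> connects R ends F. (\<Prod>e\<in>F. x e) * (\<Prod>e\<in>E - F. y e))"

lemma connectsD:
  assumes "connects R ends F" "U \<subseteq> R" "\<And>e. e \<in> F \<Longrightarrow> ends e \<subseteq> U \<or> ends e \<inter> U = {}"
  shows "U = {} \<or> U = R"
  using assms unfolding connects_def by simp

lemma connects_empty_iff:
  assumes "finite R" "R \<noteq> {}"
  shows "connects R ends {} \<longleftrightarrow> card R = 1"
proof
  assume c: "connects R ends {}"
  obtain x where x: "x \<in> R" using assms by blast
  have "{x} = R" using c x unfolding connects_def by (metis empty_iff empty_subsetI insert_not_empty insert_subset)
  then show "card R = 1" by (metis is_singletonI is_singleton_altdef)
next
  assume "card R = 1"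
  then obtain x where "R = {x}" using card_1_singletonE by blast
  then show "connects R ends {}" by (auto simp: connects_def)
qed

lemma connects_insert_loop:
  assumes "ends e = {a}"
  shows "connects R ends (insert e F) \<longleftrightarrow> connects R ends F"
  using assms unfolding connects_def by auto

text \<open>Edge-closed sets correspond under the contraction of \<open>b\<close> into
  \<open>a\<close>: a closed set downstairs is pulled back along \<open>id(b := a)\<close>, and a
  closed set upstairs, which contains both or neither of \<open>a\<close> and \<open>b\<close>,
  loses \<open>b\<close>.\<close>

lemma connects_contract:
  assumes ab: "a \<in> R" "b \<in> R" "a \<noteq> b" "ends e0 = {a, b}"
    and F: "\<And>e. e \<in> F \<Longrightarrow> ends e \<subseteq> R"
  shows "connects R ends (insert e0 F) \<longleftrightarrow>
    connects (R - {b}) (\<lambda>e. (id(b := a)) ` ends e) F"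
proof
  let ?\<sigma> = "id(b := a)"
  assume c: "connects R ends (insert e0 F)"
  show "connects (R - {b}) (\<lambda>e. ?\<sigma> ` ends e) F"
    unfolding connects_def
  proof (intro allI impI)
    fix U assume U: "U \<subseteq> R - {b}" and cl: "\<forall>e\<in>F. ?\<sigma> ` ends e \<subseteq> U \<or> ?\<sigma> ` ends e \<inter> U = {}"
    define U' where "U' = {x\<in>R. ?\<sigma> x \<in> U}"
    have "\<forall>e\<in>F. ends e \<subseteq> U' \<or> ends e \<inter> U' = {}"
    proof
      fix e assume e: "e \<in> F"
      then have "?\<sigma> ` ends e \<subseteq> U \<or> ?\<sigma> ` ends e \<inter> U = {}" using cl by blast
      then show "ends e \<subseteq> U' \<or> ends e \<inter> U' = {}"
        using F[OF e] unfolding U'_def by blast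
    qed
    moreover have "ends e0 \<subseteq> U' \<or> ends e0 \<inter> U' = {}"
      using ab by (auto simp: U'_def)
    moreover have "U' \<subseteq> R" by (auto simp: U'_def)
    ultimately have "U' = {} \<or> U' = R" by (intro connectsD[OF c]) auto
    moreover have "U = U' - {b}" using U by (auto simp: U'_def)
    ultimately show "U = {} \<or> U = R - {b}" by auto
  qed
next
  let ?\<sigma> = "id(b := a)"
  assume c: "connects (R - {b}) (\<lambda>e. ?\<sigma> ` ends e) F"
  show "connects R ends (insert e0 F)"
    unfolding connects_def
  proof (intro allI impI)
    fix U assume U: "U \<subseteq> R" and cl: "\<forall>e\<in>insert e0 F. ends e \<subseteq> U \<or> ends e \<inter> U = {}"
    have ab': "a \<in> U \<longleftrightarrow> b \<in> U" using cl ab by auto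
    \<comment> \<open>Since \<open>a\<close> and \<open>b\<close> lie in \<open>U\<close> together
      or not at all, the contraction preserves membership, so edges closed for \<open>U\<close>
      remain closed for \<open>U - {b}\<close>.\<close>
    have \<sigma>: "?\<sigma> x \<in> U - {b} \<longleftrightarrow> x \<in> U" for x using ab ab' by auto
    have "\<forall>e\<in>F. ?\<sigma> ` ends e \<subseteq> U - {b} \<or> ?\<sigma> ` ends e \<inter> (U - {b}) = {}"
    proof
      fix e assume "e \<in> F"
      then have "ends e \<subseteq> U \<or> ends e \<inter> U = {}" using cl by blast
      then have cl_e: "(\<forall>x\<in>ends e. ?\<sigma> x \<in> U - {b}) \<or> (\<forall>x\<in>ends e. ?\<sigma> x \<notin> U - {b})"
        unfolding \<sigma> by blast
      have image: "s ` A \<subseteq> V \<or> s ` A \<inter> V = {}"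
        if "(\<forall>x\<in>A. s x \<in> V) \<or> (\<forall>x\<in>A. s x \<notin> V)" for s and A V :: "'a set"
        using that by blast
      show "?\<sigma> ` ends e \<subseteq> U - {b} \<or> ?\<sigma> ` ends e \<inter> (U - {b}) = {}"
        by (rule image[OF cl_e])
    qed
    then have "U - {b} = {} \<or> U - {b} = R - {b}"
      using U by (intro connectsD[OF c]) auto
    then show "U = {} \<or> U = R"
    proof
      assume "U - {b} = {}"
      then show ?thesis using ab ab' by auto
    next
      assume eq: "U - {b} = R - {b}"
      then have "b \<in> U" using ab ab' by auto
      then show ?thesis using eq ab(2) by (metis insert_Diff)
    qed
  qed
qed

text \<open>The sum is split according to whether the edge set contains \<open>e0\<close>.\<close>

lemma conn_sum_insert:
  assumes "finite E" "e0 \<notin> E"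
  shows "conn_sum R ends (insert e0 E) x y =
    x e0 * (\<Sum>F | F \<subseteq> E \<and> connects R ends (insert e0 F). (\<Prod>e\<in>F. x e) * (\<Prod>e\<in>E - F. y e))
    + y e0 * conn_sum R ends E x y"
proof -
  let ?w = "\<lambda>F. (\<Prod>e\<in>F. x e) * (\<Prod>e\<in>insert e0 E - F. y e)"
  let ?A = "{F. F \<subseteq> E \<and> connects R ends (insert e0 F)}"
  let ?B = "{F. F \<subseteq> E \<and> connects R ends F}"
  have split: "{F. F \<subseteq> insert e0 E \<and> connects R ends F} = insert e0 ` ?A \<union> ?B" (is "?L = _")
  proof (intro equalityI subsetI)
    fix F assume F: "F \<in> ?L"
    show "F \<in> insert e0 ` ?A \<union> ?B"
    proof (cases "e0 \<in> F")
      case True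
      then have "F = insert e0 (F - {e0})" "F - {e0} \<in> ?A" using F by (auto simp: insert_absorb)
      then show ?thesis by blast
    next
      case False
      then show ?thesis using F by auto
    qed
  qed auto
  have fin: "finite ?A" "finite ?B" using assms by auto
  have inj: "inj_on (insert e0) ?A"
  proof (rule inj_onI)
    fix F F' assume "F \<in> ?A" "F' \<in> ?A" "insert e0 F = insert e0 F'"
    then show "F = F'" using assms(2) by (metis (no_types, lifting) insert_ident mem_Collect_eq subsetD)
  qed
  have "conn_sum R ends (insert e0 E) x y = sum ?w (insert e0 ` ?A \<union> ?B)"
    by (simp only: conn_sum_def split)
  also have "\<dots> = sum ?w (insert e0 ` ?A) + sum ?w ?B"
    using fin assms by (intro sum.union_disjoint) auto
  also have "sum ?w (insert e0 ` ?A) = (\<Sum>F\<in>?A. ?w (insert e0 F))"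
    using inj by (simp add: sum.reindex)
  also have "\<dots> = x e0 * (\<Sum>F\<in>?A. (\<Prod>e\<in>F. x e) * (\<Prod>e\<in>E - F. y e))"
    unfolding sum_distrib_left
  proof (rule sum.cong)
    fix F assume "F \<in> ?A"
    then have F: "F \<subseteq> E" by auto
    have "finite F" "e0 \<notin> F" "insert e0 E - insert e0 F = E - F" using F assms finite_subset by auto
    then show "?w (insert e0 F) = x e0 * ((\<Prod>e\<in>F. x e) * (\<Prod>e\<in>E - F. y e))" by (simp add: mult.assoc)
  qed simp
  also have "sum ?w ?B = y e0 * conn_sum R ends E x y"
    unfolding conn_sum_def sum_distrib_left
  proof (rule sum.cong)
    fix F assume "F \<in> ?B"
    then have F: "F \<subseteq> E" by auto
    have "insert e0 E - F = insert e0 (E - F)" "e0 \<notin> E - F" "finite (E - F)" using F assms by auto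
    then show "?w F = y e0 * ((\<Prod>e\<in>F. x e) * (\<Prod>e\<in>E - F. y e))" by (simp add: algebra_simps)
  qed simp
  finally show ?thesis .
qed

text \<open>A loop never influences connectivity, so its two states merely add up; with
  \<open>x e0 + y e0 = 1\<close> it can be deleted.\<close>

lemma conn_sum_insert_loop:
  assumes "finite E" "e0 \<notin> E" "ends e0 = {a}"
  shows "conn_sum R ends (insert e0 E) x y = (x e0 + y e0) * conn_sum R ends E x y"
  unfolding conn_sum_insert[OF assms(1,2)]
  using assms(3) by (simp add: connects_insert_loop conn_sum_def[symmetric] algebra_simps)

text \<open>Deletion-contraction: if \<open>e0\<close> is present its endpoints may be identified,
  otherwise it is removed.\<close>

lemma conn_sum_insert_contract:
  assumes "finite E" "e0 \<notin> E" "a \<in> R" "b \<in> R" "a \<noteq> b" "ends e0 = {a, b}"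
    and E: "\<And>e. e \<in> E \<Longrightarrow> ends e \<subseteq> R"
  shows "conn_sum R ends (insert e0 E) x y =
    x e0 * conn_sum (R - {b}) (\<lambda>e. (id(b := a)) ` ends e) E x y + y e0 * conn_sum R ends E x y"
proof -
  have "connects R ends (insert e0 F) \<longleftrightarrow> connects (R - {b}) (\<lambda>e. (id(b := a)) ` ends e) F"
    if "F \<subseteq> E" for F
    using connects_contract[of a R b ends e0 F] assms that by blast
  then have "{F. F \<subseteq> E \<and> connects R ends (insert e0 F)} =
      {F. F \<subseteq> E \<and> connects (R - {b}) (\<lambda>e. (id(b := a)) ` ends e) F}" by blast
  then show ?thesis
    unfolding conn_sum_insert[OF assms(1,2)] by (simp add: conn_sum_def)
qed

lemma conn_sum_empty:
  assumes "finite R" "R \<noteq> {}"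
  shows "conn_sum R ends {} x y = (if card R = 1 then 1 else 0)"
proof (cases "card R = 1")
  case True
  then have "{F. F = {} \<and> connects R ends F} = {{}}"
    using connects_empty_iff[OF assms, of ends] by auto
  then show ?thesis using True by (simp only: conn_sum_def subset_empty) simp
next
  case False
  then have "{F. F = {} \<and> connects R ends F} = {}"
    using connects_empty_iff[OF assms, of ends] by auto
  then show ?thesis using False by (simp only: conn_sum_def subset_empty) simp
qed

text \<open>
  With \<open>\<sigma> = 1\<close> the right-hand side is a connection probability; with \<open>\<sigma> = - 1\<close> it is the
  sign-corrected reliability polynomial at a negative time. The factor \<open>\<kappa>\<close> is gained once
  for each contracted edge, hence exactly \<open>card R - 1\<close> times.
\<close>

lemma norm_conn_sum_le:
  fixes x y :: "'e \<Rightarrow> 'r::{real_normed_field}" and X Y c :: "'e \<Rightarrow> real" and \<kappa> \<sigma> :: real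
  assumes "finite E" "finite R" "R \<noteq> {}"
    and "\<And>e. e \<in> E \<Longrightarrow> \<exists>a\<in>R. \<exists>b\<in>R. ends e = {a, b}"
    and "\<kappa> \<ge> 0" "\<sigma> * \<sigma> = 1"
    and "\<And>e. e \<in> E \<Longrightarrow> norm (x e) \<le> \<kappa> * (c e * X e)"
    and "\<And>e. e \<in> E \<Longrightarrow> norm (y e) \<le> c e * Y e"
    and "\<And>e. e \<in> E \<Longrightarrow> c e \<ge> 1 \<and> x e + y e = 1 \<and> \<sigma> * X e + Y e = 1"
  shows "norm (conn_sum R ends E x y) \<le>
    \<kappa> ^ (card R - 1) * (\<Prod>e\<in>E. c e) * (\<sigma> ^ (card R - 1) * conn_sum R ends E (\<lambda>e. \<sigma> * X e) Y)"
  using assms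
proof (induction E arbitrary: R ends rule: finite_induct)
  case empty
  then show ?case by (simp add: conn_sum_empty)
next
  case (insert e0 E)
  let ?n = "card R - 1"
  let ?P = "\<Prod>e\<in>E. c e"
  let ?C = "\<sigma> ^ ?n * conn_sum R ends E (\<lambda>e. \<sigma> * X e) Y"
  have IH: "norm (conn_sum R ends E x y) \<le> \<kappa> ^ ?n * ?P * ?C"
    by (rule insert.IH; (rule insert.prems)?) (use insert.prems in auto)
  obtain a b where ab: "a \<in> R" "b \<in> R" "ends e0 = {a, b}" using insert.prems(3)[OF insertI1] by blast
  have c0: "c e0 \<ge> 1" "x e0 + y e0 = 1" "\<sigma> * X e0 + Y e0 = 1"
    using insert.prems(8)[OF insertI1] by blast+
  show ?case
  proof (cases "a = b")
    case True
    \<comment> \<open>A loop leaves the left-hand side unchanged, while the right-hand side only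
      gains the factor \<open>c e0 \<ge> 1\<close>.\<close>
    have loop: "ends e0 = {a}" using ab True by simp
    have "norm (conn_sum R ends (insert e0 E) x y) = 1 * norm (conn_sum R ends E x y)"
      using conn_sum_insert_loop[where ends = ends and x = x and y = y, OF insert.hyps loop] c0 by simp
    also have "\<dots> \<le> c e0 * (\<kappa> ^ ?n * ?P * ?C)"
      using IH c0 by (intro mult_mono) auto
    also have "\<dots> = \<kappa> ^ ?n * (\<Prod>e\<in>insert e0 E. c e) *
        (\<sigma> ^ ?n * conn_sum R ends (insert e0 E) (\<lambda>e. \<sigma> * X e) Y)"
      using conn_sum_insert_loop[where ends = ends and x = "\<lambda>e. \<sigma> * X e" and y = Y, OF insert.hyps loop] c0 insert.hyps by simp
    finally show ?thesis .
  next
    case False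
    let ?R = "R - {b}" and ?ends = "\<lambda>e. (id(b := a)) ` ends e"
    let ?C' = "\<sigma> ^ (card ?R - 1) * conn_sum ?R ?ends E (\<lambda>e. \<sigma> * X e) Y"
    have E: "\<exists>a'\<in>R. \<exists>b'\<in>R. ends e = {a', b'}" if "e \<in> E" for e using insert.prems(3)[OF insertI2] that by blast
    have sub: "ends e \<subseteq> R" if "e \<in> E" for e using E[OF that] by auto
    \<comment> \<open>As \<open>a \<noteq> b\<close>, the set \<open>R\<close> has at least two
      points, so the truncated subtraction is exact and contraction lowers the exponent by
      one.\<close>
    have card: "?n = Suc (card ?R - 1)"
    proof -
      have "card {a, b} \<le> card R" using ab insert.prems(1) by (intro card_mono) auto
      then show ?thesis using ab False insert.prems(1) by (simp add: card_Diff_singleton)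
    qed
    have IH': "norm (conn_sum ?R ?ends E x y) \<le> \<kappa> ^ (card ?R - 1) * ?P * ?C'"
    proof (rule insert.IH)
      show "\<exists>a'\<in>?R. \<exists>b'\<in>?R. ?ends e = {a', b'}" if "e \<in> E" for e
      proof -
        obtain a' b' where e: "a' \<in> R" "b' \<in> R" "ends e = {a', b'}" using E \<open>e \<in> E\<close> by blast
        show ?thesis
          by (rule bexI[of _ "(id(b := a)) a'"], rule bexI[of _ "(id(b := a)) b'"])
            (use e ab False in auto)
      qed
    qed (use insert.prems(1,4-8) ab False in auto)
    have "norm (conn_sum R ends (insert e0 E) x y) =
        norm (x e0 * conn_sum ?R ?ends E x y + y e0 * conn_sum R ends E x y)"
      using conn_sum_insert_contract[where ends = ends and x = x and y = y, OF insert.hyps ab(1,2) False ab(3) sub] by simp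
    also have "\<dots> \<le> norm (x e0) * norm (conn_sum ?R ?ends E x y)
        + norm (y e0) * norm (conn_sum R ends E x y)"
      by (rule norm_triangle_le) (simp add: norm_mult)
    also have "\<dots> \<le> (\<kappa> * (c e0 * X e0)) * (\<kappa> ^ (card ?R - 1) * ?P * ?C')
        + (c e0 * Y e0) * (\<kappa> ^ ?n * ?P * ?C)"
    proof -
      have x0: "norm (x e0) \<le> \<kappa> * (c e0 * X e0)" and y0: "norm (y e0) \<le> c e0 * Y e0"
        using insert.prems(6,7)[OF insertI1] by blast+
      show ?thesis
        by (intro add_mono mult_mono x0 y0 IH IH' norm_ge_zero
            order_trans[OF norm_ge_zero x0] order_trans[OF norm_ge_zero y0])
    qed
    \<comment> \<open>A factor \<open>\<sigma> * \<sigma> = 1\<close> is inserted. One \<sigma>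
      raises the sign exponent of the contracted graph to that of \<open>R\<close>, the other turns
      \<open>X e0\<close> into the edge weight \<open>\<sigma> * X e0\<close>; so both terms carry
      the same sign and recombine by deletion-contraction.\<close>
    also have "\<dots> = \<kappa> ^ ?n * (c e0 * ?P) * ((\<sigma> * \<sigma>) * X e0 * ?C' + Y e0 * ?C)"
      unfolding insert.prems(5) card by (simp add: algebra_simps)
    also have "\<dots> = \<kappa> ^ ?n * (\<Prod>e\<in>insert e0 E. c e) *
        (\<sigma> ^ ?n * (\<sigma> * X e0 * conn_sum ?R ?ends E (\<lambda>e. \<sigma> * X e) Y
          + Y e0 * conn_sum R ends E (\<lambda>e. \<sigma> * X e) Y))"
      unfolding card prod.insert[OF insert.hyps] by (simp add: algebra_simps)
    also have "\<sigma> * X e0 * conn_sum ?R ?ends E (\<lambda>e. \<sigma> * X e) Y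
          + Y e0 * conn_sum R ends E (\<lambda>e. \<sigma> * X e) Y = conn_sum R ends (insert e0 E) (\<lambda>e. \<sigma> * X e) Y"
      by (rule conn_sum_insert_contract[where ends = ends, symmetric, OF insert.hyps ab(1,2) False ab(3) sub])
    finally show ?thesis .
  qed
qed

section \<open>Clusters and finite connected sets\<close>

lemma countable_UNIV_uprod:
  assumes "countable (UNIV :: 'v set)"
  shows "countable (UNIV :: 'v uprod set)"
proof -
  have "(UNIV :: 'v uprod set) = (\<lambda>(x, y). Upair x y) ` (UNIV \<times> UNIV)"
    by (metis (mono_tags, lifting) UNIV_I UNIV_Times_UNIV case_prod_conv image_eqI subset_antisym subsetI
        subset_UNIV uprod_exhaust)
  then show ?thesis using assms by (metis countable_SIGMA countable_image)
qed

section \<open>Countable additivity over countable index sets\<close>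

context finite_measure
begin

text \<open>The index set is transported to the naturals by \<open>to_nat_on\<close>. This map is
  injective but need not be onto, so the remaining indices receive the empty set, which does not
  change the union or the sum.\<close>

lemma
  assumes I: "countable I" and X: "\<And>i. i \<in> I \<Longrightarrow> X i \<in> sets M"
  shows has_sum_measure_UN:
      "disjoint_family_on X I \<Longrightarrow> ((\<lambda>i. measure M (X i)) has_sum measure M (\<Union>i\<in>I. X i)) I"
    and measure_UN_le_has_sum:
      "\<And>s. ((\<lambda>i. measure M (X i)) has_sum s) I \<Longrightarrow> measure M (\<Union>i\<in>I. X i) \<le> s"
proof -
  let ?N = "to_nat_on I ` I"
  define Y where "Y n = (if n \<in> ?N then X (from_nat_into I n) else {})" for n
  have Y: "range Y \<subseteq> sets M" using X by (auto simp: Y_def I)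
  have UN: "(\<Union>n. Y n) = (\<Union>i\<in>I. X i)" 
    by (auto simp: Y_def I split: if_splits)
  have iff: "((\<lambda>i. measure M (X i)) has_sum s) I \<longleftrightarrow> ((\<lambda>n. measure M (Y n)) has_sum s) UNIV" for s
  proof -
    have "((\<lambda>i. measure M (X i)) has_sum s) I \<longleftrightarrow> (((\<lambda>n. measure M (Y n)) \<circ> to_nat_on I) has_sum s) I"
      by (rule has_sum_cong) (simp add: Y_def I)
    also have "\<dots> \<longleftrightarrow> ((\<lambda>n. measure M (Y n)) has_sum s) ?N"
      by (rule has_sum_reindex[symmetric]) (simp add: I inj_on_to_nat_on)
    also have "\<dots> \<longleftrightarrow> ((\<lambda>n. measure M (Y n)) has_sum s) UNIV"
      by (rule has_sum_cong_neutral) (auto simp: Y_def)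
    finally show ?thesis .
  qed
  show "((\<lambda>i. measure M (X i)) has_sum measure M (\<Union>i\<in>I. X i)) I" if d: "disjoint_family_on X I"
  proof -
    have "disjoint_family Y"
      using d unfolding disjoint_family_on_def Y_def by (auto simp: I) blast
    then have "(\<lambda>n. measure M (Y n)) sums measure M (\<Union>n. Y n)"
      using Y by (intro finite_measure_UNION)
    then have "((\<lambda>n. measure M (Y n)) has_sum measure M (\<Union>n. Y n)) UNIV"
      by (intro sums_nonneg_imp_has_sum) auto
    then show ?thesis unfolding iff UN .
  qed
  show "measure M (\<Union>i\<in>I. X i) \<le> s" if s: "((\<lambda>i. measure M (X i)) has_sum s) I" for s
  proof -
    have "(\<lambda>n. measure M (Y n)) sums s" using s unfolding iff by (rule has_sum_imp_sums)
    then have "measure M (\<Union>n. Y n) \<le> s"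
      using finite_measure_subadditive_countably[OF Y] by (simp add: sums_iff)
    then show ?thesis unfolding UN .
  qed
qed

end

section \<open>Clusters described by inner and boundary pairs\<close>

definition inner_pairs :: "'v set \<Rightarrow> 'v uprod set"
  where "inner_pairs S = {e. set_uprod e \<subseteq> S}"

definition boundary_pairs :: "'v set \<Rightarrow> 'v uprod set"
  where "boundary_pairs S = {e. set_uprod e \<inter> S \<noteq> {} \<and> \<not> set_uprod e \<subseteq> S}"

lemma inner_pairs_eq: "inner_pairs S = (\<lambda>(x, y). Upair x y) ` (S \<times> S)"
proof (intro equalityI subsetI)
  fix e assume "e \<in> inner_pairs S"
  then show "e \<in> (\<lambda>(x, y). Upair x y) ` (S \<times> S)"
    by (cases e) (auto simp: inner_pairs_def)
qed (auto simp: inner_pairs_def)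

lemma finite_inner_pairs: "finite S \<Longrightarrow> finite (inner_pairs S)"
  by (simp add: inner_pairs_eq)

lemma inner_boundary_disjoint: "boundary_pairs S \<inter> inner_pairs S = {}"
  by (auto simp: inner_pairs_def boundary_pairs_def)

text \<open>This presents the pairs that meet \<open>S\<close> as an image of ordered pairs, whose
  total mass is computed row by row.\<close>

lemma inner_Un_boundary: "inner_pairs S \<union> boundary_pairs S = (\<lambda>(x, y). Upair x y) ` (S \<times> UNIV)"
proof (intro equalityI subsetI)
  fix e assume "e \<in> inner_pairs S \<union> boundary_pairs S"
  then show "e \<in> (\<lambda>(x, y). Upair x y) ` (S \<times> UNIV)"
  proof (cases e)
    case (Upair a b)
    then have "a \<in> S \<or> b \<in> S"
      using \<open>e \<in> inner_pairs S \<union> boundary_pairs S\<close> by (auto simp: inner_pairs_def boundary_pairs_def)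
    then show ?thesis
    proof
      assume "a \<in> S"
      then show ?thesis using Upair by (intro image_eqI[of _ _ "(a, b)"]) auto
    next
      assume "b \<in> S"
      then show ?thesis using Upair by (intro image_eqI[of _ _ "(b, a)"]) auto
    qed
  qed
qed (auto simp: inner_pairs_def boundary_pairs_def)

lemma mem_cluster_self: "v \<in> cluster \<omega> v"
  by (simp add: cluster_def)

lemma mem_cluster_step:
  assumes "x \<in> cluster \<omega> v" "\<omega> (Upair x y)"
  shows "y \<in> cluster \<omega> v"
  using assms by (auto simp: cluster_def intro: rtranclp.rtrancl_into_rtrancl)

lemma cluster_subsetI:
  assumes "v \<in> U" "\<And>x y. x \<in> U \<Longrightarrow> \<omega> (Upair x y) \<Longrightarrow> y \<in> U"
  shows "cluster \<omega> v \<subseteq> U"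
proof
  fix w assume "w \<in> cluster \<omega> v"
  then have "(\<lambda>x y. \<omega> (Upair x y))\<^sup>*\<^sup>* v w" by (simp add: cluster_def)
  then show "w \<in> U" by (induction) (use assms in auto)
qed

text \<open>The event splits into a condition on the finitely many inner pairs (if \<open>S\<close>
  is finite) and one on the disjoint set of boundary pairs, hence into independent factors.
  Connectivity holds because an edge-closed part of the cluster either contains \<open>v\<close> and
  so everything reachable, or its complement does; conversely the cluster itself is an edge-closed
  part of \<open>S\<close>.\<close>

lemma cluster_eq_iff:
  assumes "v \<in> S"
  shows "cluster \<omega> v = S \<longleftrightarrow>
    connects S set_uprod {e \<in> inner_pairs S. \<omega> e} \<and> (\<forall>e\<in>boundary_pairs S. \<not> \<omega> e)"
proof
  assume S: "cluster \<omega> v = S"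
  have bd: "\<not> \<omega> e" if e: "e \<in> boundary_pairs S" for e
  proof
    assume \<omega>: "\<omega> e"
    have step: "y \<in> S" if "x \<in> S" "\<omega> (Upair x y)" for x y using mem_cluster_step that S by metis
    have swap: "Upair x y = Upair y x" for x y :: 'a by simp
    show False
    proof (cases e)
      case (Upair x y)
      then show False using e \<omega> step[of x y] step[of y x] swap[of x y]
        by (auto simp: boundary_pairs_def simp del: Upair_inject)
    qed
  qed
  have "connects S set_uprod {e \<in> inner_pairs S. \<omega> e}"
    unfolding connects_def
  proof (intro allI impI)
    fix U assume U: "U \<subseteq> S"
      and cl: "\<forall>e\<in>{e \<in> inner_pairs S. \<omega> e}. set_uprod e \<subseteq> U \<or> set_uprod e \<inter> U = {}"
    have iff: "x \<in> U \<longleftrightarrow> y \<in> U" if "x \<in> S" "\<omega> (Upair x y)" for x y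
    proof -
      have "y \<in> S" using mem_cluster_step that S by metis
      then show ?thesis using cl[rule_format, of "Upair x y"] that by (auto simp: inner_pairs_def)
    qed
    have stepS: "y \<in> S" if "x \<in> S" "\<omega> (Upair x y)" for x y using mem_cluster_step that S by metis
    show "U = {} \<or> U = S"
    proof (cases "v \<in> U")
      case True
      have "cluster \<omega> v \<subseteq> U"
        by (rule cluster_subsetI) (use True iff U in blast)+
      then show ?thesis using S U by blast
    next
      case False
      have "cluster \<omega> v \<subseteq> S - U"
        by (rule cluster_subsetI) (use False assms iff stepS in blast)+
      then show ?thesis using S U by blast
    qed
  qed
  then show "connects S set_uprod {e \<in> inner_pairs S. \<omega> e} \<and> (\<forall>e\<in>boundary_pairs S. \<not> \<omega> e)"
    using bd by blast
next
  assume a: "connects S set_uprod {e \<in> inner_pairs S. \<omega> e} \<and> (\<forall>e\<in>boundary_pairs S. \<not> \<omega> e)"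
  have sub: "cluster \<omega> v \<subseteq> S"
  proof (rule cluster_subsetI[OF assms])
    fix x y assume "x \<in> S" "\<omega> (Upair x y)"
    then show "y \<in> S" using a by (force simp: boundary_pairs_def)
  qed
  have closed: "\<forall>e\<in>{e \<in> inner_pairs S. \<omega> e}. set_uprod e \<subseteq> cluster \<omega> v \<or> set_uprod e \<inter> cluster \<omega> v = {}"
  proof
    fix e assume e: "e \<in> {e \<in> inner_pairs S. \<omega> e}"
    have swap: "Upair x y = Upair y x" for x y :: 'a by simp
    show "set_uprod e \<subseteq> cluster \<omega> v \<or> set_uprod e \<inter> cluster \<omega> v = {}"
    proof (cases e)
      case (Upair x y)
      then show ?thesis using e mem_cluster_step[of x \<omega> v y] mem_cluster_step[of y \<omega> v x] swap[of x y]
        by (auto simp del: Upair_inject)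
    qed
  qed
  have "cluster \<omega> v = {} \<or> cluster \<omega> v = S"
    by (rule connectsD[OF conjunct1[OF a] sub]) (rule closed[rule_format])
  then show "cluster \<omega> v = S" using mem_cluster_self[of v \<omega>] by auto
qed

text \<open>The set is grown one vertex at a time: as long as it is not the whole cluster, an
  occupied pair leads out of it. The lemma feeds the union bound on
  \<open>Pr(|C(v)| \<ge> m)\<close>.\<close>

lemma exists_connected_subset:
  assumes "m \<ge> 1" "infinite (cluster \<omega> v) \<or> m \<le> card (cluster \<omega> v)"
  shows "\<exists>S. v \<in> S \<and> finite S \<and> card S = m \<and> S \<subseteq> cluster \<omega> v \<and>
    connects S set_uprod {e \<in> inner_pairs S. \<omega> e}"
  using assms
proof (induction m rule: nat_induct_at_least)
  case base
  have "connects {v} set_uprod {e \<in> inner_pairs {v}. \<omega> e}" by (auto simp: connects_def)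
  then show ?case using mem_cluster_self[of v \<omega>] by (intro exI[of _ "{v}"]) simp
next
  case (Suc m)
  then have "infinite (cluster \<omega> v) \<or> m \<le> card (cluster \<omega> v)" by linarith
  from Suc.IH[OF this] obtain S where S: "v \<in> S" "finite S" "card S = m" "S \<subseteq> cluster \<omega> v"
    and c: "connects S set_uprod {e \<in> inner_pairs S. \<omega> e}" by blast
  have "S \<noteq> cluster \<omega> v" using S Suc.prems by auto
  then have "\<not> cluster \<omega> v \<subseteq> S" using S by auto
  have "\<exists>x y. x \<in> S \<and> \<omega> (Upair x y) \<and> y \<notin> S"
  proof (rule ccontr)
    assume none: "\<nexists>x y. x \<in> S \<and> \<omega> (Upair x y) \<and> y \<notin> S"
    have "cluster \<omega> v \<subseteq> S"
      by (rule cluster_subsetI[OF S(1)]) (use none in auto)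
    then show False using \<open>\<not> cluster \<omega> v \<subseteq> S\<close> by simp
  qed
  then obtain x y where xy: "x \<in> S" "\<omega> (Upair x y)" "y \<notin> S" by auto
  have "y \<in> cluster \<omega> v" by (rule mem_cluster_step[of x \<omega> v]) (use xy S(4) in auto)
  moreover have "connects (insert y S) set_uprod {e \<in> inner_pairs (insert y S). \<omega> e}"
    unfolding connects_def
  proof (intro allI impI)
    fix U assume U: "U \<subseteq> insert y S"
      and cl: "\<forall>e\<in>{e \<in> inner_pairs (insert y S). \<omega> e}. set_uprod e \<subseteq> U \<or> set_uprod e \<inter> U = {}"
    \<comment> \<open>The new vertex \<open>y\<close> hangs on \<open>x\<close> by an occupied pair,
      so a closed set treats them alike and is determined by its trace on \<open>S\<close>.\<close>
    have xU: "x \<in> U \<longleftrightarrow> y \<in> U" using cl[rule_format, of "Upair x y"] xy by (auto simp: inner_pairs_def)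
    have closed: "\<forall>e\<in>{e \<in> inner_pairs S. \<omega> e}. set_uprod e \<subseteq> U \<inter> S \<or> set_uprod e \<inter> (U \<inter> S) = {}"
    proof
      fix e assume e: "e \<in> {e \<in> inner_pairs S. \<omega> e}"
      then have "e \<in> {e \<in> inner_pairs (insert y S). \<omega> e}" by (auto simp: inner_pairs_def)
      then have "set_uprod e \<subseteq> U \<or> set_uprod e \<inter> U = {}" using cl by blast
      then show "set_uprod e \<subseteq> U \<inter> S \<or> set_uprod e \<inter> (U \<inter> S) = {}"
        using e by (auto simp: inner_pairs_def)
    qed
    have "U \<inter> S = {} \<or> U \<inter> S = S"
      by (rule connectsD[OF c Int_lower2]) (rule closed[rule_format])
    then show "U = {} \<or> U = insert y S"
    proof
      assume "U \<inter> S = {}"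
      then show ?thesis using U xy xU by auto
    next
      assume "U \<inter> S = S"
      then have "S \<subseteq> U" "y \<in> U" using xy xU by auto
      then show ?thesis using U by auto
    qed
  qed
  ultimately show ?case using S xy by (intro exI[of _ "insert y S"]) auto
qed

section \<open>Entire weights of finite clusters\<close>

lemma conn_sum_of_real:
  "conn_sum R ends E (\<lambda>e. of_real (x e)) (\<lambda>e. of_real (y e)) =
    (of_real (conn_sum R ends E x y) :: 'r::{real_algebra_1,comm_ring_1})"
  by (simp add: conn_sum_def)

text \<open>The power series without its constant term is estimated term by term.\<close>

lemma norm_exp_minus_one_le:
  fixes w :: complex
  shows "norm (1 - exp w) \<le> exp (norm w) - 1"
proof -
  have w: "(\<lambda>n. w ^ Suc n /\<^sub>R fact (Suc n)) sums (exp w - 1)"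
    using sums_Suc_iff[of "\<lambda>n. w ^ n /\<^sub>R fact n" "exp w - 1"] exp_converges[of w] by simp
  have r: "(\<lambda>n. norm w ^ Suc n /\<^sub>R fact (Suc n)) sums (exp (norm w) - 1)"
    using sums_Suc_iff[of "\<lambda>n. norm w ^ n /\<^sub>R fact n" "exp (norm w) - 1"] exp_converges[of "norm w"] by simp
  have "norm (exp w - 1) \<le> exp (norm w) - 1"
    unfolding sums_unique[OF w] sums_unique[OF r]
    by (rule norm_suminf_le) (use r in \<open>auto simp: norm_mult norm_power sums_iff simp del: fact_Suc power_Suc\<close>)
  then show ?thesis by (simp add: norm_minus_commute)
qed

text \<open>By convexity the exponential lies below its chord between \<open>0\<close> and
  \<open>s * x\<close>. The slope \<open>a / s\<close> becomes the gain per contracted edge.\<close>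

lemma exp_minus_one_le_linear:
  fixes a x s :: real
  assumes "0 \<le> a" "a \<le> s" "s > 0"
  shows "exp (a * x) - 1 \<le> a / s * (exp (s * x) - 1)"
proof -
  have "exp ((1 - a / s) *\<^sub>R 0 + (a / s) *\<^sub>R (s * x)) \<le> (1 - a / s) * exp 0 + a / s * exp (s * x)"
    using assms by (intro convex_onD[OF exp_convex]) auto
  then show ?thesis using assms by (simp add: algebra_simps)
qed

text \<open>Comparison with time \<open>1\<close>: \<open>1 - exp (- x)\<close> is the occupation
  probability of a pair of mass \<open>x\<close>. The cost \<open>exp ((a + 1) * x)\<close> is
  affordable since the masses add up to at most the number of vertices.\<close>

lemma exp_minus_one_le_mult:
  fixes a x :: real
  assumes "0 \<le> a" "0 \<le> x"
  shows "exp (a * x) - 1 \<le> a * (exp ((a + 1) * x) * (1 - exp (- x)))"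
proof -
  have "exp (a * x) - 1 = exp (a * x) * (1 - exp (- (a * x)))"
    by (simp add: right_diff_distrib exp_minus)
  also have "\<dots> \<le> exp (a * x) * (a * x)"
    using exp_ge_add_one_self[of "- (a * x)"] by (intro mult_left_mono) auto
  also have "\<dots> \<le> exp (a * x) * (a * (exp x - 1))"
    using exp_ge_add_one_self[of x] assms by (intro mult_left_mono) (linarith | simp)+
  also have "\<dots> = a * (exp ((a + 1) * x) * (1 - exp (- x)))"
    by (simp add: algebra_simps exp_add exp_minus)
  finally show ?thesis .
qed

section \<open>Weights of a finite set and their comparison between times\<close>

context long_range_model
begin

text \<open>Each vertex of \<open>S\<close> has total mass one, and every pair that meets
  \<open>S\<close> occurs at least once among the ordered pairs in
  \<open>S \<times> UNIV\<close>.\<close>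

lemma
  assumes S: "finite S"
  shows summable_boundary: "\<mu> summable_on boundary_pairs S"
    and mass_inner_boundary_le: "sum \<mu> (inner_pairs S) + infsum \<mu> (boundary_pairs S) \<le> card S"
proof -
  define g where "g = (\<lambda>(x, y). Upair x y :: 'v uprod)"
  have one: "((\<lambda>y. \<mu> (g (x, y))) has_sum 1) UNIV" for x
    using total_mass[of x] by (simp add: g_def)
  have summ: "(\<lambda>p. \<mu> (g p)) summable_on (S \<times> UNIV)"
    by (rule summable_on_SigmaI[where g = "\<lambda>_. 1"]) (use one S nonneg in auto)
  have tot: "((\<lambda>p. \<mu> (g p)) has_sum real (card S)) (S \<times> UNIV)"
    by (rule has_sum_SigmaI[where g = "\<lambda>_. 1"]) (use one S summ has_sum_finite[of S "\<lambda>_. 1 :: real"] in auto)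
  \<comment> \<open>\<open>g\<close> is not injective, because inner pairs with distinct endpoints
    are hit twice; \<open>A\<close> selects one ordered representative for each pair.\<close>
  obtain A where A: "A \<subseteq> S \<times> UNIV" "inj_on g A" "inner_pairs S \<union> boundary_pairs S = g ` A"
    using inner_Un_boundary[of S] subset_image_inj[of "inner_pairs S \<union> boundary_pairs S" g "S \<times> UNIV"]
    unfolding g_def by auto
  have sA: "(\<lambda>p. \<mu> (g p)) summable_on A"
    using summ A(1) by (rule summable_on_subset_banach)
  have "infsum (\<lambda>p. \<mu> (g p)) A \<le> infsum (\<lambda>p. \<mu> (g p)) (S \<times> UNIV)"
    by (rule infsum_mono2) (use sA summ A nonneg in auto)
  then have le: "infsum \<mu> (inner_pairs S \<union> boundary_pairs S) \<le> card S"
    using infsumI[OF tot] infsum_reindex[OF A(2), of \<mu>] A(3) by (simp add: o_def)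
  have su: "\<mu> summable_on (inner_pairs S \<union> boundary_pairs S)"
    unfolding A(3) using sA summable_on_reindex[OF A(2), of \<mu>] by (simp add: o_def)
  show b: "\<mu> summable_on boundary_pairs S"
    using su by (rule summable_on_subset_banach) simp
  have "infsum \<mu> (inner_pairs S \<union> boundary_pairs S) = infsum \<mu> (inner_pairs S) + infsum \<mu> (boundary_pairs S)"
    using b finite_inner_pairs[OF S] inner_boundary_disjoint[of S]
    by (intro infsum_Un_disjoint) auto
  then show "sum \<mu> (inner_pairs S) + infsum \<mu> (boundary_pairs S) \<le> card S"
    using le finite_inner_pairs[OF S] by simp
qed

text \<open>For real \<open>z \<ge> 0\<close> and finite \<open>S\<close> this is the probability
  that \<open>S\<close> is internally connected. It is polymorphic so that real values and the
  entire extension share one formula.\<close>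

definition connected_weight :: "'v set \<Rightarrow> 'r::{real_normed_field,banach} \<Rightarrow> 'r"
  where "connected_weight S z = conn_sum S set_uprod (inner_pairs S)
    (\<lambda>e. 1 - exp (- z * of_real (\<mu> e))) (\<lambda>e. exp (- z * of_real (\<mu> e)))"

text \<open>For real \<open>z \<ge> 0\<close> and finite \<open>S\<close> this is the probability
  that the cluster of \<open>v\<close> equals \<open>S\<close>, for any \<open>v\<close> in
  \<open>S\<close>.\<close>

definition cluster_weight :: "'v set \<Rightarrow> 'r::{real_normed_field,banach} \<Rightarrow> 'r"
  where "cluster_weight S z =
    connected_weight S z * exp (- z * of_real (infsum \<mu> (boundary_pairs S)))"

lemma connected_weight_of_real:
  "connected_weight S (of_real t :: complex) = of_real (connected_weight S t)"
  unfolding connected_weight_def conn_sum_of_real[symmetric] by (simp flip: exp_of_real)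

lemma cluster_weight_of_real:
  "cluster_weight S (of_real t :: complex) = of_real (cluster_weight S t)"
  unfolding cluster_weight_def connected_weight_of_real by (simp flip: exp_of_real)

lemma inner_pairs_ends:
  "e \<in> inner_pairs S \<Longrightarrow> \<exists>a\<in>S. \<exists>b\<in>S. set_uprod e = {a, b}"
  by (cases e) (auto simp: inner_pairs_def)

lemma norm_edge_le:
  fixes z :: complex
  shows "norm (1 - exp (- z * of_real (\<mu> e))) \<le> exp (norm z * \<mu> e) - 1"
    and "norm (exp (- z * of_real (\<mu> e))) \<le> exp (norm z * \<mu> e)"
  using norm_exp_minus_one_le[of "- z * of_real (\<mu> e)"] norm_exp[of "- z * of_real (\<mu> e)"] nonneg[of e]
  by (simp_all add: norm_mult)

text \<open>Comparison with the positive time \<open>1\<close>, using \<sigma> = 1, \<kappa> =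
  \<open>norm z\<close> and the edge costs \<open>exp ((norm z + 1) * \<mu> e)\<close>.\<close>

lemma norm_connected_weight_le:
  fixes z :: complex
  assumes "finite S" "S \<noteq> {}"
  shows "norm (connected_weight S z) \<le>
    norm z ^ (card S - 1) * exp ((norm z + 1) * sum \<mu> (inner_pairs S)) * connected_weight S (1::real)"
proof -
  let ?a = "norm z"
  have "norm (connected_weight S z) \<le> ?a ^ (card S - 1) *
    (\<Prod>e\<in>inner_pairs S. exp ((?a + 1) * \<mu> e)) * (1 ^ (card S - 1) *
      conn_sum S set_uprod (inner_pairs S) (\<lambda>e. 1 * (1 - exp (- \<mu> e))) (\<lambda>e. exp (- \<mu> e)))"
    unfolding connected_weight_def
  proof (rule norm_conn_sum_le)
    fix e
    show "norm (1 - exp (- z * of_real (\<mu> e))) \<le> ?a * (exp ((?a + 1) * \<mu> e) * (1 - exp (- \<mu> e)))"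
      using norm_edge_le(1) exp_minus_one_le_mult[OF norm_ge_zero nonneg] by (rule order_trans)
    show "norm (exp (- z * of_real (\<mu> e))) \<le> exp ((?a + 1) * \<mu> e) * exp (- \<mu> e)"
      using norm_edge_le(2)[of z e] by (simp add: algebra_simps flip: exp_add)
    show "1 \<le> exp ((?a + 1) * \<mu> e) \<and> 1 - exp (- z * of_real (\<mu> e)) + exp (- z * of_real (\<mu> e)) = 1
        \<and> 1 * (1 - exp (- \<mu> e)) + exp (- \<mu> e) = 1"
      using nonneg by simp
  qed (use assms finite_inner_pairs inner_pairs_ends in auto)
  also have "\<dots> = ?a ^ (card S - 1) * exp ((?a + 1) * sum \<mu> (inner_pairs S)) * connected_weight S (1::real)"
    using finite_inner_pairs[OF assms(1)] by (simp add: connected_weight_def exp_sum sum_distrib_left)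
  finally show ?thesis .
qed

text \<open>Comparison with the negative time \<open>- s\<close>, using \<sigma> = - 1, \<kappa> =
  \<open>norm z / s\<close> and no edge costs.\<close>

lemma norm_connected_weight_le_neg:
  fixes z :: complex and s :: real
  assumes "finite S" "S \<noteq> {}" "norm z \<le> s" "s > 0"
  shows "norm (connected_weight S z) \<le>
    (norm z / s) ^ (card S - 1) * ((- 1) ^ (card S - 1) * connected_weight S (- s))"
proof -
  have "norm (connected_weight S z) \<le> (norm z / s) ^ (card S - 1) *
    (\<Prod>e\<in>inner_pairs S. 1) * ((- 1) ^ (card S - 1) *
      conn_sum S set_uprod (inner_pairs S) (\<lambda>e. - 1 * (exp (s * \<mu> e) - 1)) (\<lambda>e. exp (s * \<mu> e)))"
    unfolding connected_weight_def
  proof (rule norm_conn_sum_le)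
    fix e
    show "norm (1 - exp (- z * of_real (\<mu> e))) \<le> norm z / s * (1 * (exp (s * \<mu> e) - 1))"
      using norm_edge_le(1)[of z e] exp_minus_one_le_linear[OF norm_ge_zero assms(3,4), of "\<mu> e"] by simp
    show "norm (exp (- z * of_real (\<mu> e))) \<le> 1 * exp (s * \<mu> e)"
    proof -
      have "norm z * \<mu> e \<le> s * \<mu> e" using assms(3) nonneg by (intro mult_right_mono)
      then show ?thesis using norm_edge_le(2)[of z e] by (simp add: order_trans)
    qed
  qed (use assms finite_inner_pairs inner_pairs_ends in auto)
  then show ?thesis by (simp add: connected_weight_def)
qed

lemma norm_cluster_weight_le:
  fixes z :: complex
  assumes "finite S" "S \<noteq> {}"
  shows "norm (cluster_weight S z) \<le>
    norm z ^ (card S - 1) * exp ((norm z + 1) * card S) * cluster_weight S (1::real)"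
proof -
  let ?a = "norm z" and ?i = "sum \<mu> (inner_pairs S)" and ?b = "infsum \<mu> (boundary_pairs S)"
  have b0: "0 \<le> ?b" using nonneg by (intro infsum_nonneg)
  have i: "norm (connected_weight S z) \<le> ?a ^ (card S - 1) * exp ((?a + 1) * ?i) * connected_weight S (1::real)"
    using assms by (rule norm_connected_weight_le)
  have c1: "0 \<le> connected_weight S (1::real)"
    using order_trans[OF norm_ge_zero norm_connected_weight_le[OF assms, of 1]] by (simp add: zero_le_mult_iff)
  have ne: "norm (exp (- z * of_real ?b)) \<le> exp (?a * ?b)"
    using norm_exp[of "- z * of_real ?b"] b0 by (simp add: norm_mult)
  have "norm (cluster_weight S z) \<le>
      (?a ^ (card S - 1) * exp ((?a + 1) * ?i) * connected_weight S (1::real)) * exp (?a * ?b)"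
    unfolding cluster_weight_def norm_mult
    by (rule mult_mono[OF i ne]) (use c1 in auto)
  \<comment> \<open>The boundary factor is brought into the same form as the inner ones by
    \<open>exp (a b) = exp ((a + 1) b) exp (- b)\<close>, so that inner and boundary mass add up to
    at most \<open>card S\<close>.\<close>
  also have "\<dots> = ?a ^ (card S - 1) * exp ((?a + 1) * (?i + ?b)) * cluster_weight S (1::real)"
    unfolding cluster_weight_def by (simp add: algebra_simps exp_add exp_minus)
  also have "\<dots> \<le> ?a ^ (card S - 1) * exp ((?a + 1) * card S) * cluster_weight S (1::real)"
  proof -
    have "(?a + 1) * (?i + ?b) \<le> (?a + 1) * card S"
      using mass_inner_boundary_le[OF assms(1)] by (intro mult_left_mono) auto
    then show ?thesis using c1 by (intro mult_right_mono mult_left_mono) (auto simp: cluster_weight_def)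
  qed
  finally show ?thesis .
qed

lemma norm_cluster_weight_le_neg:
  fixes z :: complex and s :: real
  assumes "finite S" "S \<noteq> {}" "norm z \<le> s" "s > 0"
  shows "norm (cluster_weight S z) \<le>
    (norm z / s) ^ (card S - 1) * ((- 1) ^ (card S - 1) * cluster_weight S (- s))"
proof -
  let ?b = "infsum \<mu> (boundary_pairs S)"
  have b0: "0 \<le> ?b" using nonneg by (intro infsum_nonneg)
  note i = norm_connected_weight_le_neg[OF assms]
  have "norm (exp (- z * of_real ?b)) \<le> exp (norm z * ?b)"
    using norm_exp[of "- z * of_real ?b"] b0 by (simp add: norm_mult)
  also have "\<dots> \<le> exp (s * ?b)" using assms(3) b0 by (simp add: mult_right_mono)
  finally have ne: "norm (exp (- z * of_real ?b)) \<le> exp (s * ?b)" .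
  have "norm (cluster_weight S z) \<le>
      ((norm z / s) ^ (card S - 1) * ((- 1) ^ (card S - 1) * connected_weight S (- s))) * exp (s * ?b)"
    unfolding cluster_weight_def norm_mult
    by (rule mult_mono[OF i ne]) (use order_trans[OF norm_ge_zero i] in auto)
  then show ?thesis by (simp add: cluster_weight_def mult_ac)
qed

text \<open>The events that \<open>S\<close> is internally connected overlap for different
  \<open>S\<close>. Here they are dominated by the probabilities at time \<open>1\<close> of the
  disjoint events that the cluster is exactly \<open>S\<close>, which makes a union bound over
  \<open>S\<close> summable.\<close>

lemma connected_weight_le:
  fixes t :: real
  assumes "finite S" "S \<noteq> {}" "0 \<le> t"
  shows "connected_weight S t \<le> t ^ (card S - 1) * exp ((t + 1) * card S) * cluster_weight S (1::real)"
proof -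
  let ?i = "sum \<mu> (inner_pairs S)" and ?b = "infsum \<mu> (boundary_pairs S)"
  have b0: "0 \<le> ?b" using nonneg by (intro infsum_nonneg)
  have c1: "0 \<le> connected_weight S (1::real)"
    using order_trans[OF norm_ge_zero norm_connected_weight_le[OF assms(1,2), of 1]] by (simp add: zero_le_mult_iff)
  have "connected_weight S t \<le> norm (connected_weight S (of_real t :: complex))"
    by (simp add: connected_weight_of_real)
  also have "\<dots> \<le> t ^ (card S - 1) * exp ((t + 1) * ?i) * connected_weight S 1"
    using norm_connected_weight_le[OF assms(1,2), of "of_real t"] assms(3) by simp
  also have "\<dots> = t ^ (card S - 1) * exp ((t + 1) * ?i + ?b) * cluster_weight S 1"
    by (simp add: cluster_weight_def exp_add exp_minus)
  also have "\<dots> \<le> t ^ (card S - 1) * exp ((t + 1) * card S) * cluster_weight S 1"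
  proof -
    have "(t + 1) * ?i + ?b \<le> (t + 1) * (?i + ?b)" using assms(3) b0 by (simp add: algebra_simps)
    also have "\<dots> \<le> (t + 1) * card S"
      using mass_inner_boundary_le[OF assms(1)] assms(3) by (intro mult_left_mono) auto
    finally show ?thesis using c1 assms(3)
      by (intro mult_right_mono mult_left_mono) (auto simp: cluster_weight_def)
  qed
  finally show ?thesis .
qed

lemma holomorphic_cluster_weight: "(cluster_weight S :: complex \<Rightarrow> complex) holomorphic_on A"
proof -
  have "(\<lambda>z :: complex. cluster_weight S z) holomorphic_on A"
    unfolding cluster_weight_def connected_weight_def conn_sum_def
    by (intro holomorphic_intros)
  then show ?thesis .
qed

end

section \<open>Probabilities of finite patterns\<close>

text \<open>The initial images of the enumeration exhaust \<open>B\<close>. They are taken as sets,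
  so repetitions, which occur for finite \<open>B\<close>, are not counted twice.\<close>

lemma has_sum_compose_from_nat_into:
  fixes f :: "'a \<Rightarrow> 'b::{comm_monoid_add,topological_space}"
  assumes "(f has_sum s) B" "countable B" "B \<noteq> {}"
  shows "(\<lambda>n. sum f (from_nat_into B ` {..n})) \<longlonglongrightarrow> s"
proof -
  have "filterlim (\<lambda>n. from_nat_into B ` {..n}) (finite_subsets_at_top B) sequentially"
    unfolding filterlim_finite_subsets_at_top
  proof (intro allI impI)
    fix X assume X: "finite X \<and> X \<subseteq> B"
    then have "finite (to_nat_on B ` X)" by simp
    then obtain N where N: "to_nat_on B ` X \<subseteq> {..N}" by (auto simp: finite_nat_iff_bounded_le)
    show "\<forall>\<^sub>F n in sequentially. finite (from_nat_into B ` {..n}) \<and> X \<subseteq> from_nat_into B ` {..n}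
        \<and> from_nat_into B ` {..n} \<subseteq> B"
    proof (rule eventually_sequentiallyI[of N], intro conjI)
      fix n assume "N \<le> n"
      show "X \<subseteq> from_nat_into B ` {..n}"
      proof
        fix x assume x: "x \<in> X"
        then have "to_nat_on B x \<le> n" using N \<open>N \<le> n\<close> by auto
        moreover have "from_nat_into B (to_nat_on B x) = x" using x X assms by auto
        ultimately show "x \<in> from_nat_into B ` {..n}" by (metis atMost_iff image_eqI)
      qed
      show "from_nat_into B ` {..n} \<subseteq> B" using assms(3) from_nat_into[of B] by auto
    qed simp
  qed
  then show ?thesis
    using assms(1) unfolding has_sum_def by (rule filterlim_compose[rotated])
qed

context long_range_model
begin

lemma countable_pairs: "countable (B :: 'v uprod set)"
  using countable_UNIV_uprod[OF countable_V] by (rule countable_subset[rotated]) simp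

lemma product_perc: "product_prob_space (\<lambda>e. measure_pmf (bernoulli_pmf (1 - exp (- t * \<mu> e))))"
  by unfold_locales

lemma prob_space_perc: "prob_space (perc \<mu> t)"
  unfolding perc_def by (intro prob_space_PiM prob_space_measure_pmf)

lemma measurable_perc_component [measurable]: "(\<lambda>\<omega>. \<omega> e) \<in> measurable (perc \<mu> t) (count_space UNIV)"
  unfolding perc_def by (rule measurable_compose[OF measurable_component_singleton]) auto

lemma sets_perc_pattern:
  "{\<omega> \<in> space (perc \<mu> t). (\<forall>e\<in>F. \<omega> e) \<and> (\<forall>e\<in>B. \<not> \<omega> e)} \<in> sets (perc \<mu> t)"
proof -
  note [simp] = countable_pairs
  show ?thesis by measurable
qed

lemma measure_pattern_finite:
  assumes "t \<ge> 0" "finite F" "finite B" "F \<inter> B = {}"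
  shows "measure (perc \<mu> t) {\<omega> \<in> space (perc \<mu> t). (\<forall>e\<in>F. \<omega> e) \<and> (\<forall>e\<in>B. \<not> \<omega> e)} =
    (\<Prod>e\<in>F. 1 - exp (- t * \<mu> e)) * (\<Prod>e\<in>B. exp (- t * \<mu> e))"
proof -
  let ?M = "\<lambda>e. measure_pmf (bernoulli_pmf (1 - exp (- t * \<mu> e)))"
  interpret product_prob_space ?M UNIV by (rule product_perc)
  let ?X = "\<lambda>e. if e \<in> F then {True} else {False}"
  have p: "0 \<le> 1 - exp (- t * \<mu> e)" "1 - exp (- t * \<mu> e) \<le> 1" for e
    using assms(1) nonneg[of e] by auto
  have "{\<omega> \<in> space (PiM UNIV ?M). (\<forall>e\<in>F. \<omega> e) \<and> (\<forall>e\<in>B. \<not> \<omega> e)} = emb UNIV (F \<union> B) (Pi\<^sub>E (F \<union> B) ?X)"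
    using assms(4) by (auto simp: prod_emb_def space_PiM PiE_iff split: if_splits) blast
  then have "measure (perc \<mu> t) {\<omega> \<in> space (perc \<mu> t). (\<forall>e\<in>F. \<omega> e) \<and> (\<forall>e\<in>B. \<not> \<omega> e)} =
      (\<Prod>e\<in>F \<union> B. measure (?M e) (?X e))"
    unfolding perc_def using assms by (simp only:) (rule measure_PiM_emb, auto)
  also have "\<dots> = (\<Prod>e\<in>F. measure (?M e) (?X e)) * (\<Prod>e\<in>B. measure (?M e) (?X e))"
    using assms by (intro prod.union_disjoint) auto
  also have "(\<Prod>e\<in>F. measure (?M e) (?X e)) = (\<Prod>e\<in>F. 1 - exp (- t * \<mu> e))"
    using p by (intro prod.cong) (auto simp: measure_pmf_single)
  also have "(\<Prod>e\<in>B. measure (?M e) (?X e)) = (\<Prod>e\<in>B. exp (- t * \<mu> e))"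
    using p assms(4) by (intro prod.cong) (auto simp: measure_pmf_single)
  finally show ?thesis .
qed

text \<open>Infinitely many vacancy conditions are imposed as a decreasing limit of finitely many;
  summability of \<open>\<mu>\<close> on \<open>B\<close> gives the limit of the product.\<close>

lemma measure_pattern:
  assumes "t \<ge> 0" "finite F" "finite E" "F \<inter> E = {}" "F \<inter> B = {}" "E \<inter> B = {}" "\<mu> summable_on B"
  shows "measure (perc \<mu> t) {\<omega> \<in> space (perc \<mu> t). (\<forall>e\<in>F. \<omega> e) \<and> (\<forall>e\<in>E \<union> B. \<not> \<omega> e)} =
    (\<Prod>e\<in>F. 1 - exp (- t * \<mu> e)) * (\<Prod>e\<in>E. exp (- t * \<mu> e)) * exp (- t * infsum \<mu> B)"
\<comment> \<open>The enumeration \<open>from_nat_into B\<close> takes values in \<open>B\<close>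
  only if \<open>B\<close> is nonempty.\<close>
proof (cases "B = {}")
  case True
  then show ?thesis using measure_pattern_finite[OF assms(1-4)] by simp
next
  case False
  interpret prob_space "perc \<mu> t" by (rule prob_space_perc)
  define B' where "B' n = from_nat_into B ` {..n}" for n
  define A where "A n = {\<omega> \<in> space (perc \<mu> t). (\<forall>e\<in>F. \<omega> e) \<and> (\<forall>e\<in>E \<union> B' n. \<not> \<omega> e)}" for n
  have sub: "B' n \<subseteq> B" for n using False from_nat_into[of B] by (auto simp: B'_def)
  have UN: "(\<Union>n. B' n) = B"
  proof
    show "B \<subseteq> (\<Union>n. B' n)"
    proof
      fix b assume "b \<in> B"
      then obtain n where "from_nat_into B n = b" using from_nat_into_surj[OF countable_pairs] by blast
      then show "b \<in> (\<Union>n. B' n)" by (auto simp: B'_def)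
    qed
  qed (use sub in blast)
  have INT: "(\<Inter>n. A n) = {\<omega> \<in> space (perc \<mu> t). (\<forall>e\<in>F. \<omega> e) \<and> (\<forall>e\<in>E \<union> B. \<not> \<omega> e)}"
    unfolding A_def UN[symmetric] by auto
  have "A n \<in> sets (perc \<mu> t)" for n unfolding A_def by (rule sets_perc_pattern)
  moreover have "decseq A" 
  proof (rule decseq_SucI)
    fix n
    have "B' n \<subseteq> B' (Suc n)" by (auto simp: B'_def)
    then show "A (Suc n) \<subseteq> A n" by (auto simp: A_def)
  qed
  ultimately have lim: "(\<lambda>n. measure (perc \<mu> t) (A n)) \<longlonglongrightarrow> measure (perc \<mu> t) (\<Inter>n. A n)"
    by (intro finite_Lim_measure_decseq) auto
  have A: "measure (perc \<mu> t) (A n) =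
      (\<Prod>e\<in>F. 1 - exp (- t * \<mu> e)) * (\<Prod>e\<in>E. exp (- t * \<mu> e)) * exp (- t * sum \<mu> (B' n))" for n
  proof -
    have fin: "finite (B' n)" by (simp add: B'_def)
    have "F \<inter> (E \<union> B' n) = {}" using sub[of n] assms by blast
    then have "measure (perc \<mu> t) (A n) =
      (\<Prod>e\<in>F. 1 - exp (- t * \<mu> e)) * (\<Prod>e\<in>E \<union> B' n. exp (- t * \<mu> e))"
      unfolding A_def using assms fin by (intro measure_pattern_finite) auto
    also have "(\<Prod>e\<in>E \<union> B' n. exp (- t * \<mu> e)) = (\<Prod>e\<in>E. exp (- t * \<mu> e)) * (\<Prod>e\<in>B' n. exp (- t * \<mu> e))"
      using sub[of n] assms fin by (intro prod.union_disjoint) auto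
    also have "(\<Prod>e\<in>B' n. exp (- t * \<mu> e)) = exp (- t * sum \<mu> (B' n))"
      using fin by (simp add: exp_sum sum_distrib_left sum_negf[symmetric] flip: exp_sum)
    finally show ?thesis by (simp add: mult.assoc)
  qed
  have "(\<lambda>n. sum \<mu> (B' n)) \<longlonglongrightarrow> infsum \<mu> B"
    unfolding B'_def using assms(7) countable_pairs False
    by (intro has_sum_compose_from_nat_into) auto
  then have "(\<lambda>n. measure (perc \<mu> t) (A n)) \<longlonglongrightarrow>
      (\<Prod>e\<in>F. 1 - exp (- t * \<mu> e)) * (\<Prod>e\<in>E. exp (- t * \<mu> e)) * exp (- t * infsum \<mu> B)"
    unfolding A by (intro tendsto_intros)
  with lim show ?thesis unfolding INT by (rule LIMSEQ_unique)
qed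

text \<open>The event is decomposed by the exact set of occupied pairs in \<open>E\<close>, which
  gives the summands of \<open>conn_sum\<close>.\<close>

lemma connects_pattern_eq:
  "{\<omega> \<in> space (perc \<mu> t). connects S ends {e \<in> E. \<omega> e} \<and> (\<forall>e\<in>B. \<not> \<omega> e)} =
    (\<Union>F\<in>{F. F \<subseteq> E \<and> connects S ends F}.
      {\<omega> \<in> space (perc \<mu> t). (\<forall>e\<in>F. \<omega> e) \<and> (\<forall>e\<in>(E - F) \<union> B. \<not> \<omega> e)})" (is "?L = ?R")
proof (intro equalityI subsetI)
  fix \<omega> assume "\<omega> \<in> ?L"
  then show "\<omega> \<in> ?R" by (intro UN_I[of "{e \<in> E. \<omega> e}"]) auto
next
  fix \<omega> assume "\<omega> \<in> ?R"
  then obtain F where F: "F \<subseteq> E" "connects S ends F" "\<omega> \<in> space (perc \<mu> t)"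
    "\<forall>e\<in>F. \<omega> e" "\<forall>e\<in>(E - F) \<union> B. \<not> \<omega> e" by blast
  then have "{e \<in> E. \<omega> e} = F" by blast
  then show "\<omega> \<in> ?L" using F by simp
qed

lemma
  assumes "finite E"
  shows sets_connects: "{\<omega> \<in> space (perc \<mu> t). connects S ends {e \<in> E. \<omega> e} \<and> (\<forall>e\<in>B. \<not> \<omega> e)} \<in> sets (perc \<mu> t)"
    and measure_connects: "t \<ge> 0 \<Longrightarrow> B \<inter> E = {} \<Longrightarrow> \<mu> summable_on B \<Longrightarrow>
      measure (perc \<mu> t) {\<omega> \<in> space (perc \<mu> t). connects S ends {e \<in> E. \<omega> e} \<and> (\<forall>e\<in>B. \<not> \<omega> e)} =
      conn_sum S ends E (\<lambda>e. 1 - exp (- t * \<mu> e)) (\<lambda>e. exp (- t * \<mu> e)) * exp (- t * infsum \<mu> B)"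
proof -
  interpret prob_space "perc \<mu> t" by (rule prob_space_perc)
  let ?I = "{F. F \<subseteq> E \<and> connects S ends F}"
  let ?A = "\<lambda>F. {\<omega> \<in> space (perc \<mu> t). (\<forall>e\<in>F. \<omega> e) \<and> (\<forall>e\<in>(E - F) \<union> B. \<not> \<omega> e)}"
  have fin: "finite ?I" using assms by auto
  show "{\<omega> \<in> space (perc \<mu> t). connects S ends {e \<in> E. \<omega> e} \<and> (\<forall>e\<in>B. \<not> \<omega> e)} \<in> sets (perc \<mu> t)"
    unfolding connects_pattern_eq using fin sets_perc_pattern by (intro sets.finite_UN) auto
  assume a: "t \<ge> 0" "B \<inter> E = {}" "\<mu> summable_on B"
  have "disjoint_family_on ?A ?I"
  proof (unfold disjoint_family_on_def, intro ballI impI)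
    fix F G assume FG: "F \<in> ?I" "G \<in> ?I" "F \<noteq> G"
    \<comment> \<open>Distinct patterns prescribe opposite states to some pair, so their events are
      disjoint.\<close>
    then have "\<exists>e. e \<in> F \<and> e \<in> E - G \<or> e \<in> G \<and> e \<in> E - F" by blast
    then show "?A F \<inter> ?A G = {}" by auto
  qed
  then have "measure (perc \<mu> t) (\<Union>F\<in>?I. ?A F) = (\<Sum>F\<in>?I. measure (perc \<mu> t) (?A F))"
    using fin sets_perc_pattern by (intro finite_measure_finite_Union) auto
  also have "\<dots> = (\<Sum>F\<in>?I. (\<Prod>e\<in>F. 1 - exp (- t * \<mu> e)) * (\<Prod>e\<in>E - F. exp (- t * \<mu> e)) * exp (- t * infsum \<mu> B))"
  proof (rule sum.cong)
    fix F assume "F \<in> ?I"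
    then have F: "F \<subseteq> E" by simp
    show "measure (perc \<mu> t) (?A F) =
        (\<Prod>e\<in>F. 1 - exp (- t * \<mu> e)) * (\<Prod>e\<in>E - F. exp (- t * \<mu> e)) * exp (- t * infsum \<mu> B)"
      using a F assms finite_subset[OF F assms] by (intro measure_pattern) auto
  qed simp
  finally show "measure (perc \<mu> t) {\<omega> \<in> space (perc \<mu> t). connects S ends {e \<in> E. \<omega> e} \<and> (\<forall>e\<in>B. \<not> \<omega> e)} =
      conn_sum S ends E (\<lambda>e. 1 - exp (- t * \<mu> e)) (\<lambda>e. exp (- t * \<mu> e)) * exp (- t * infsum \<mu> B)"
    unfolding connects_pattern_eq conn_sum_def sum_distrib_right .
qed

lemma
  assumes "finite S" "v \<in> S"
  shows sets_cluster_eq: "{\<omega> \<in> space (perc \<mu> t). cluster \<omega> v = S} \<in> sets (perc \<mu> t)"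
    and measure_cluster_eq: "t \<ge> 0 \<Longrightarrow>
      measure (perc \<mu> t) {\<omega> \<in> space (perc \<mu> t). cluster \<omega> v = S} = cluster_weight S t"
  unfolding cluster_eq_iff[OF assms(2)] cluster_weight_def connected_weight_def
  using sets_connects[OF finite_inner_pairs[OF assms(1)]]
    measure_connects[OF finite_inner_pairs[OF assms(1)] _ inner_boundary_disjoint summable_boundary[OF assms(1)]]
  by auto

lemma
  assumes "finite S"
  shows sets_connected: "{\<omega> \<in> space (perc \<mu> t). connects S set_uprod {e \<in> inner_pairs S. \<omega> e}} \<in> sets (perc \<mu> t)"
    and measure_connected: "t \<ge> 0 \<Longrightarrow>
      measure (perc \<mu> t) {\<omega> \<in> space (perc \<mu> t). connects S set_uprod {e \<in> inner_pairs S. \<omega> e}} =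
      connected_weight S t"
  unfolding connected_weight_def
  using sets_connects[OF finite_inner_pairs[OF assms(1)], where B = "{}"]
    measure_connects[OF finite_inner_pairs[OF assms(1)], where B = "{}"]
  by auto

end

section \<open>Cluster size distribution\<close>

lemma zero_islimpt_of_real_interval:
  fixes \<delta> :: real
  assumes "\<delta> > 0"
  shows "(0::complex) islimpt (of_real ` {0<..<\<delta>})"
  unfolding islimpt_approachable
proof (intro allI impI)
  fix e :: real assume "e > 0"
  then show "\<exists>x'\<in>of_real ` {0<..<\<delta>}. x' \<noteq> 0 \<and> dist x' (0::complex) < e"
    using assms by (intro bexI[of _ "of_real (min e \<delta> / 2)"] imageI) (auto simp: norm_divide)
qed

text \<open>Identity theorem: both functions agree on the real interval \<open>(0, 1)\<close>, which
  accumulates at \<open>0\<close>.\<close>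

lemma entire_extension_unique:
  assumes "entire_extension g h" "entire_extension g' h"
  shows "g = g'"
proof
  fix z
  have hol: "g holomorphic_on UNIV" "g' holomorphic_on UNIV"
    using assms by (auto simp: entire_extension_def)
  have "g z - g' z = 0"
  proof (rule analytic_continuation[OF holomorphic_on_diff[OF hol], of "of_real ` {0<..<1}" 0])
    show "(0::complex) islimpt of_real ` {0<..<1}" by (rule zero_islimpt_of_real_interval) simp
    show "g w - g' w = 0" if "w \<in> of_real ` {0<..<1}" for w
      using that assms by (auto simp: entire_extension_def)
  qed (auto simp: connected_UNIV)
  then show "g z = g' z" by simp
qed

text \<open>The sets need not coincide: it suffices that to the right of each point of
  \<open>B\<close> all of the interval up to \<open>0\<close> lies in \<open>A\<close>, since these
  points come arbitrarily close.\<close>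

lemma Inf_ereal_eqI:
  assumes "A \<subseteq> B" "\<And>r r'. r \<in> B \<Longrightarrow> r < r' \<Longrightarrow> r' < 0 \<Longrightarrow> r' \<in> A" "\<And>r. r \<in> B \<Longrightarrow> r < 0"
  shows "Inf (ereal ` A) = Inf (ereal ` B)"
proof (rule antisym)
  show "Inf (ereal ` B) \<le> Inf (ereal ` A)" using assms(1) by (intro Inf_superset_mono image_mono)
  show "Inf (ereal ` A) \<le> Inf (ereal ` B)"
  proof (rule Inf_greatest)
    fix x assume "x \<in> ereal ` B"
    then obtain r where r: "r \<in> B" "x = ereal r" by blast
    show "Inf (ereal ` A) \<le> x"
    proof (rule dense_ge_bounded)
      show "x < 0" using r assms(3) by (simp add: zero_ereal_def)
      fix w :: ereal assume w: "x < w" "w < 0"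
      then obtain r' where r': "w = ereal r'" using r by (cases w) auto
      then have "r' \<in> A" using assms(2)[OF r(1)] w r by (auto simp: zero_ereal_def)
      then show "Inf (ereal ` A) \<le> w" unfolding r' by (intro Inf_lower imageI)
    qed
  qed
qed

section \<open>The cluster size distribution as a series of entire functions\<close>

context long_range_model
begin

definition clusters_of_size :: "'v \<Rightarrow> nat \<Rightarrow> 'v set set"
  where "clusters_of_size v m = {S. v \<in> S \<and> finite S \<and> card S = m}"

text \<open>For \<open>m \<ge> 1\<close> this is the explicit form of the entire extension of
  \<open>Pr(|C(v)| = m)\<close>.\<close>

definition cluster_series :: "'v \<Rightarrow> nat \<Rightarrow> complex \<Rightarrow> complex"
  where "cluster_series v m z = (\<Sum>\<^sub>\<infinity>S\<in>clusters_of_size v m. cluster_weight S z)"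

lemma countable_clusters_of_size: "countable (clusters_of_size v m)"
proof -
  have "countable {S :: 'v set. finite S \<and> S \<subseteq> UNIV}"
    using countable_V by (rule countable_Collect_finite_subset)
  then show ?thesis by (rule countable_subset[rotated]) (auto simp: clusters_of_size_def)
qed

lemma
  assumes "m \<ge> 1"
  shows sets_card_cluster_eq:
      "{\<omega> \<in> space (perc \<mu> t). finite (cluster \<omega> v) \<and> card (cluster \<omega> v) = m} \<in> sets (perc \<mu> t)"
    and has_sum_cluster_weight: "t \<ge> 0 \<Longrightarrow>
      ((\<lambda>S. cluster_weight S t) has_sum prob_cluster_eq \<mu> v m t) (clusters_of_size v m)"
proof -
  interpret prob_space "perc \<mu> t" by (rule prob_space_perc)
  let ?X = "\<lambda>S. {\<omega> \<in> space (perc \<mu> t). cluster \<omega> v = S}"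
  have eq: "{\<omega> \<in> space (perc \<mu> t). finite (cluster \<omega> v) \<and> card (cluster \<omega> v) = m} =
      (\<Union>S\<in>clusters_of_size v m. ?X S)"
    using mem_cluster_self[of v] by (auto simp: clusters_of_size_def)
  have X: "?X S \<in> sets (perc \<mu> t)" if "S \<in> clusters_of_size v m" for S
    using that by (intro sets_cluster_eq) (auto simp: clusters_of_size_def)
  show "{\<omega> \<in> space (perc \<mu> t). finite (cluster \<omega> v) \<and> card (cluster \<omega> v) = m} \<in> sets (perc \<mu> t)"
    unfolding eq using countable_clusters_of_size X by (intro sets.countable_UN') auto
  assume t: "t \<ge> 0"
  have "((\<lambda>S. measure (perc \<mu> t) (?X S)) has_sum prob_cluster_eq \<mu> v m t) (clusters_of_size v m)"
    unfolding prob_cluster_eq_def eq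
    by (rule has_sum_measure_UN) (auto simp: countable_clusters_of_size X disjoint_family_on_def)
  then show "((\<lambda>S. cluster_weight S t) has_sum prob_cluster_eq \<mu> v m t) (clusters_of_size v m)"
    by (rule has_sum_cong[THEN iffD1, rotated])
      (use t in \<open>auto simp: clusters_of_size_def measure_cluster_eq\<close>)
qed

lemma prob_cluster_eq_le_one: "prob_cluster_eq \<mu> v m t \<le> 1"
proof -
  interpret prob_space "perc \<mu> t" by (rule prob_space_perc)
  show ?thesis unfolding prob_cluster_eq_def by (rule prob_le_1)
qed

text \<open>A cluster contains \<open>v\<close>, so its size is never \<open>0\<close>, and the
  complementary event consists of the sizes \<open>1\<close> to \<open>n\<close>.\<close>

lemma prob_cluster_ge_eq:
  "prob_cluster_ge \<mu> v (Suc n) t = 1 - (\<Sum>k<n. prob_cluster_eq \<mu> v (Suc k) t)"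
proof -
  interpret prob_space "perc \<mu> t" by (rule prob_space_perc)
  let ?X = "\<lambda>k. {\<omega> \<in> space (perc \<mu> t). finite (cluster \<omega> v) \<and> card (cluster \<omega> v) = Suc k}"
  have eq: "{\<omega> \<in> space (perc \<mu> t). infinite (cluster \<omega> v) \<or> Suc n \<le> card (cluster \<omega> v)} =
      space (perc \<mu> t) - (\<Union>k<n. ?X k)"
  proof (intro equalityI subsetI)
    fix \<omega> assume \<omega>: "\<omega> \<in> space (perc \<mu> t) - (\<Union>k<n. ?X k)"
    show "\<omega> \<in> {\<omega> \<in> space (perc \<mu> t). infinite (cluster \<omega> v) \<or> Suc n \<le> card (cluster \<omega> v)}"
    proof (cases "finite (cluster \<omega> v)")
      case True
      then have "card (cluster \<omega> v) > 0" using mem_cluster_self[of v \<omega>] by (auto simp: card_gt_0_iff)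
      then obtain k where k: "card (cluster \<omega> v) = Suc k" using gr0_implies_Suc by blast
      then have "\<not> k < n" using \<omega> True by auto
      then show ?thesis using \<omega> k by auto
    qed (use \<omega> in auto)
  qed auto
  have "prob_cluster_ge \<mu> v (Suc n) t = 1 - measure (perc \<mu> t) (\<Union>k<n. ?X k)"
    unfolding prob_cluster_ge_def eq by (rule prob_compl) (intro sets.finite_UN sets_card_cluster_eq, auto)
  also have "measure (perc \<mu> t) (\<Union>k<n. ?X k) = (\<Sum>k<n. measure (perc \<mu> t) (?X k))"
    by (rule finite_measure_finite_Union) (auto simp: disjoint_family_on_def intro!: sets_card_cluster_eq)
  finally show ?thesis unfolding prob_cluster_eq_def .
qed

text \<open>Union bound over the internally connected \<open>m\<close>-sets containing
  \<open>v\<close>. After comparison with time \<open>1\<close> the probabilities sum to a constant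
  times \<open>Pr(|C(v)| = m)\<close> at time \<open>1\<close>, which is at most one.\<close>

lemma prob_cluster_ge_le:
  assumes "m \<ge> 1" "t \<ge> 0"
  shows "prob_cluster_ge \<mu> v m t \<le> t ^ (m - 1) * exp ((t + 1) * m)"
proof -
  interpret prob_space "perc \<mu> t" by (rule prob_space_perc)
  let ?I = "clusters_of_size v m" and ?K = "t ^ (m - 1) * exp ((t + 1) * m)"
  let ?X = "\<lambda>S. {\<omega> \<in> space (perc \<mu> t). connects S set_uprod {e \<in> inner_pairs S. \<omega> e}}"
  have I: "finite S" "S \<noteq> {}" "card S = m" if "S \<in> ?I" for S
    using that by (auto simp: clusters_of_size_def)
  have X: "?X S \<in> sets (perc \<mu> t)" if "S \<in> ?I" for S using I[OF that] by (intro sets_connected)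
  have one: "((\<lambda>S. cluster_weight S (1::real)) has_sum prob_cluster_eq \<mu> v m 1) ?I"
    using assms by (intro has_sum_cluster_weight) auto
  have K: "((\<lambda>S. ?K * cluster_weight S (1::real)) has_sum ?K * prob_cluster_eq \<mu> v m 1) ?I"
    using one by (rule has_sum_cmult_right)
  have le: "measure (perc \<mu> t) (?X S) \<le> ?K * cluster_weight S 1" if "S \<in> ?I" for S
    using connected_weight_le[OF I(1,2)[OF that] assms(2)] I[OF that] assms(2)
    by (simp add: measure_connected)
  have summ: "(\<lambda>S. measure (perc \<mu> t) (?X S)) summable_on ?I"
    by (rule summable_on_comparison_test[OF has_sum_imp_summable[OF K]]) (use le in auto)
  have sub: "{\<omega> \<in> space (perc \<mu> t). infinite (cluster \<omega> v) \<or> m \<le> card (cluster \<omega> v)} \<subseteq> (\<Union>S\<in>?I. ?X S)"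
  proof
    fix \<omega> assume \<omega>: "\<omega> \<in> {\<omega> \<in> space (perc \<mu> t). infinite (cluster \<omega> v) \<or> m \<le> card (cluster \<omega> v)}"
    then have "infinite (cluster \<omega> v) \<or> m \<le> card (cluster \<omega> v)" by simp
    from exists_connected_subset[OF assms(1) this]
    obtain S where "S \<in> ?I" "connects S set_uprod {e \<in> inner_pairs S. \<omega> e}"
      by (auto simp: clusters_of_size_def)
    then show "\<omega> \<in> (\<Union>S\<in>?I. ?X S)" using \<omega> by blast
  qed
  have "prob_cluster_ge \<mu> v m t \<le> measure (perc \<mu> t) (\<Union>S\<in>?I. ?X S)"
    unfolding prob_cluster_ge_def using sub countable_clusters_of_size X
    by (intro finite_measure_mono sets.countable_UN') auto
  also have "\<dots> \<le> infsum (\<lambda>S. measure (perc \<mu> t) (?X S)) ?I"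
    by (rule measure_UN_le_has_sum) (use countable_clusters_of_size X summ in auto)
  also have "\<dots> \<le> ?K * prob_cluster_eq \<mu> v m 1"
    using has_sum_mono[OF has_sum_infsum[OF summ] K] le by blast
  also have "\<dots> \<le> ?K * 1"
    using prob_cluster_eq_le_one assms(2) by (intro mult_left_mono) auto
  finally show ?thesis by simp
qed

text \<open>Weierstrass test on a disc: the majorant is a constant times the probability at time
  \<open>1\<close> that the cluster equals \<open>S\<close>, which is summable over
  \<open>S\<close>.\<close>

lemma
  assumes "m \<ge> 1"
  shows cluster_series_uniform_limit: "uniform_limit (cball 0 r) (\<lambda>X z. \<Sum>S\<in>X. cluster_weight S z) (cluster_series v m)
    (finite_subsets_at_top (clusters_of_size v m))"
    and cluster_weight_abs_summable: "norm z \<le> r \<Longrightarrow> (\<lambda>S. norm (cluster_weight S (z::complex))) summable_on clusters_of_size v m"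
proof -
  let ?I = "clusters_of_size v m"
  let ?M = "\<lambda>S. \<bar>r\<bar> ^ (m - 1) * exp ((\<bar>r\<bar> + 1) * m) * cluster_weight S (1::real)"
  have I: "finite S" "S \<noteq> {}" "card S = m" if "S \<in> ?I" for S
    using that by (auto simp: clusters_of_size_def)
  have M: "?M summable_on ?I"
    using has_sum_imp_summable[OF has_sum_cluster_weight[OF assms zero_le_one]]
    by (intro summable_on_cmult_right)
  have le: "norm (cluster_weight S z) \<le> ?M S" if S: "S \<in> ?I" and z: "norm z \<le> r" for S and z :: complex
  proof -
    have c: "0 \<le> cluster_weight S (1::real)"
      using measure_cluster_eq[OF I(1)[OF S], of v 1] S
      by (metis (no_types, lifting) clusters_of_size_def measure_nonneg mem_Collect_eq zero_le_one)
    have "norm (cluster_weight S z) \<le> norm z ^ (m - 1) * exp ((norm z + 1) * m) * cluster_weight S (1::real)"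
      using norm_cluster_weight_le[OF I(1,2)[OF S], of z] I(3)[OF S] by simp
    also have "\<dots> \<le> ?M S"
    proof -
      have "(norm z + 1) * m \<le> (\<bar>r\<bar> + 1) * m" using z by (intro mult_right_mono) auto
      then show ?thesis using z c by (intro mult_right_mono mult_mono power_mono) auto
    qed
    finally show ?thesis .
  qed
  show "uniform_limit (cball 0 r) (\<lambda>X z. \<Sum>S\<in>X. cluster_weight S z) (cluster_series v m)
      (finite_subsets_at_top ?I)"
    unfolding cluster_series_def using le M by (intro Weierstrass_m_test_general) auto
  show "(\<lambda>S. norm (cluster_weight S z)) summable_on ?I" if "norm z \<le> r"
    by (rule summable_on_comparison_test[OF M]) (use le that in auto)
qed

lemma cluster_series_has_sum:
  assumes "m \<ge> 1"
  shows "((\<lambda>S. cluster_weight S z) has_sum cluster_series v m z) (clusters_of_size v m)"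
  unfolding cluster_series_def
  by (intro has_sum_infsum abs_summable_summable[OF cluster_weight_abs_summable[OF assms order_refl]])

lemma entire_extension_cluster_series:
  assumes "m \<ge> 1"
  shows "entire_extension (cluster_series v m) (prob_cluster_eq \<mu> v m)"
  unfolding entire_extension_def
proof (intro conjI allI impI)
  show "cluster_series v m holomorphic_on UNIV"
  proof (rule holomorphic_onI)
    fix z :: complex
    have "cluster_series v m holomorphic_on ball 0 (norm z + 1)"
    proof (rule holomorphic_uniform_limit[OF _ cluster_series_uniform_limit[OF assms]])
      show "\<forall>\<^sub>F X in finite_subsets_at_top (clusters_of_size v m).
          continuous_on (cball 0 (norm z + 1)) (\<lambda>z::complex. \<Sum>S\<in>X. cluster_weight S z) \<and>
          (\<lambda>z. \<Sum>S\<in>X. cluster_weight S z) holomorphic_on ball 0 (norm z + 1)"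
        by (intro always_eventually allI conjI continuous_on_sum holomorphic_on_sum
            holomorphic_on_imp_continuous_on holomorphic_cluster_weight)
    qed auto
    then show "cluster_series v m field_differentiable at z within UNIV"
      by (rule holomorphic_on_imp_differentiable_at) auto
  qed
  fix t :: real assume "t \<ge> 0"
  then have "((\<lambda>S. complex_of_real (cluster_weight S t)) has_sum of_real (prob_cluster_eq \<mu> v m t))
      (clusters_of_size v m)"
    using assms by (intro has_sum_of_real has_sum_cluster_weight)
  then show "cluster_series v m (of_real t) = of_real (prob_cluster_eq \<mu> v m t)"
    using cluster_series_has_sum[OF assms, of "of_real t" v]
    by (simp add: cluster_weight_of_real has_sum_unique)
qed

text \<open>All sets in the series have \<open>m\<close> elements, so at time \<open>- s\<close>
  every weight has the same sign \<open>(- 1) ^ (m - 1)\<close>. The sum of absolute values is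
  therefore the absolute value of the sum, and the bound for single weights passes to the
  series.\<close>

lemma norm_cluster_series_le:
  fixes s :: real
  assumes "m \<ge> 1" "norm z \<le> s" "s > 0"
  shows "norm (cluster_series v m z) \<le> (norm z / s) ^ (m - 1) * norm (cluster_series v m (of_real (- s)))"
proof -
  let ?I = "clusters_of_size v m" and ?q = "(norm z / s) ^ (m - 1)" and ?\<sigma> = "(- 1) ^ (m - 1) :: real"
  have I: "finite S" "S \<noteq> {}" "card S = m" if "S \<in> ?I" for S
    using that assms(1) by (auto simp: clusters_of_size_def)
  have "((\<lambda>S. Re (cluster_weight S (of_real (- s)))) has_sum Re (cluster_series v m (of_real (- s)))) ?I"
    using cluster_series_has_sum[OF assms(1)] by (rule has_sum_Re)
  then have "((\<lambda>S. cluster_weight S (- s)) has_sum Re (cluster_series v m (of_real (- s)))) ?I"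
    unfolding cluster_weight_of_real by simp
  then have R: "((\<lambda>S. ?q * (?\<sigma> * cluster_weight S (- s))) has_sum
      ?q * (?\<sigma> * Re (cluster_series v m (of_real (- s))))) ?I"
    by (intro has_sum_cmult_right)
  have summ: "(\<lambda>S. norm (cluster_weight S z)) summable_on ?I"
    by (rule cluster_weight_abs_summable[OF assms(1) order_refl])
  have "norm (cluster_series v m z) \<le> infsum (\<lambda>S. norm (cluster_weight S z)) ?I"
    unfolding cluster_series_def by (rule norm_infsum_bound[OF summ])
  also have "\<dots> \<le> ?q * (?\<sigma> * Re (cluster_series v m (of_real (- s))))"
    using norm_cluster_weight_le_neg[OF _ _ assms(2,3)] I
    by (intro has_sum_mono[OF has_sum_infsum[OF summ] R]) metis
  also have "?\<sigma> * Re (cluster_series v m (of_real (- s))) \<le> norm (cluster_series v m (of_real (- s)))"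
  proof -
    have "\<bar>?\<sigma> * Re (cluster_series v m (of_real (- s)))\<bar> \<le> norm (cluster_series v m (of_real (- s)))"
      using abs_Re_le_cmod by (simp add: abs_mult power_abs)
    then show ?thesis by linarith
  qed
  finally show ?thesis using assms(3) by (simp add: mult_left_mono)
qed

lemma sum_cluster_series_eq_one:
  assumes "s > 0" "norm z < s" "(\<lambda>m. cluster_series v m (of_real (- s))) \<longlonglongrightarrow> 0"
  shows "(\<lambda>k. cluster_series v (Suc k) z) sums 1"
proof -
  define P where "P k z = cluster_series v (Suc k) z" for k z
  obtain C where C: "norm (cluster_series v m (of_real (- s))) \<le> C" for m
    using convergent_imp_Bseq[of "\<lambda>m. cluster_series v m (of_real (- s))"] assms(3)
    unfolding Bseq_def convergent_def by blast
  have C0: "C \<ge> 0" using order_trans[OF norm_ge_zero C] .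
  \<comment> \<open>The midpoint between \<open>norm z\<close> and \<open>s\<close>: the disc of
    radius \<rho> contains \<open>z\<close>, and the series is dominated there by a geometric one of
    ratio \<open>\<rho> / s < 1\<close>.\<close>
  define \<rho> where "\<rho> = (norm z + s) / 2"
  have \<rho>: "norm z < \<rho>" "0 < \<rho>" "\<rho> < s" 
    using assms(1,2) add_nonneg_pos[OF norm_ge_zero[of z] assms(1)] by (simp_all add: \<rho>_def)
  have bound: "norm (P k w) \<le> C * (\<rho> / s) ^ k" if "norm w \<le> \<rho>" for k w
  proof -
    have "norm (P k w) \<le> (norm w / s) ^ k * norm (cluster_series v (Suc k) (of_real (- s)))"
      using norm_cluster_series_le[of "Suc k" w s v] that \<rho> assms(1) by (simp add: P_def)
    also have "\<dots> \<le> (\<rho> / s) ^ k * C"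
      using that \<rho> assms(1) C0 by (intro mult_mono power_mono divide_right_mono C) auto
    finally show ?thesis by (simp add: mult.commute)
  qed
  have geo: "summable (\<lambda>k. C * (\<rho> / s) ^ k)"
    using \<rho> assms(1) by (intro summable_mult summable_geometric) auto
  have sumP: "summable (\<lambda>k. P k w)" if "norm w \<le> \<rho>" for w
    by (rule summable_comparison_test'[OF geo]) (use bound that in auto)
  have holP: "P k holomorphic_on A" for k A
    unfolding P_def
    by (rule holomorphic_on_subset[of _ UNIV])
      (use entire_extension_cluster_series[of "Suc k" v] in \<open>auto simp: entire_extension_def\<close>)
  define F where "F w = (\<Sum>k. P k w)" for w
  have "uniform_limit (cball 0 \<rho>) (\<lambda>n w. \<Sum>k<n. P k w) F sequentially"
    unfolding F_def by (rule Weierstrass_m_test[OF _ geo]) (use bound in auto)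
  then have holF: "F holomorphic_on ball 0 \<rho>"
  proof (rule holomorphic_uniform_limit[rotated])
    show "\<forall>\<^sub>F n in sequentially. continuous_on (cball 0 \<rho>) (\<lambda>w. \<Sum>k<n. P k w) \<and>
        (\<lambda>w. \<Sum>k<n. P k w) holomorphic_on ball 0 \<rho>"
      by (intro always_eventually allI conjI continuous_on_sum holomorphic_on_sum
          holomorphic_on_imp_continuous_on holP)
  qed auto
  \<comment> \<open>For \<open>t < exp (- 2)\<close> the tail bound
    \<open>t ^ n * exp ((t + 1) * Suc n)\<close> is at most \<open>exp 2 * (t * exp 2) ^ n\<close>,
    which tends to zero; so clusters are almost surely finite at these times.\<close>
  define \<delta> where "\<delta> = min \<rho> (exp (- 2))"
  have \<delta>: "0 < \<delta>" "\<delta> \<le> \<rho>" "\<delta> \<le> exp (- 2)" using \<rho> by (auto simp: \<delta>_def)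
  have F1: "F (of_real t) = 1" if t: "0 < t" "t < \<delta>" for t
  proof -
    have t1: "t < exp (- 2)" "t \<le> 1"
      using t \<delta> exp_le_one_iff[of "- 2 :: real"] by linarith+
    let ?g = "\<lambda>n. prob_cluster_ge \<mu> v (Suc n) t"
    have le: "?g n \<le> exp 2 * (t * exp 2) ^ n" for n
    proof -
      have "?g n \<le> t ^ n * exp ((t + 1) * Suc n)"
        using prob_cluster_ge_le[of "Suc n" t v] t by simp
      also have "\<dots> \<le> t ^ n * exp (2 * Suc n)"
      proof -
        have "(t + 1) * real (Suc n) \<le> 2 * real (Suc n)" using t1 by (intro mult_right_mono) auto
        then show ?thesis using t by (intro mult_left_mono) auto
      qed
      also have "\<dots> = exp 2 * (t * exp 2) ^ n"
        by (simp add: exp_add distrib_left exp_of_nat_mult[symmetric] power_mult_distrib mult_ac)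
      finally show ?thesis .
    qed
    have "t * exp 2 < exp (- 2) * exp 2" using t1 by (intro mult_strict_right_mono) auto
    then have "t * exp 2 < 1" by (simp flip: exp_add)
    then have "(\<lambda>n. exp 2 * (t * exp 2) ^ n) \<longlonglongrightarrow> 0"
      using t by (intro tendsto_mult_right_zero LIMSEQ_realpow_zero) auto
    then have "?g \<longlonglongrightarrow> 0"
    proof (rule Lim_null_comparison[rotated])
      show "\<forall>\<^sub>F n in sequentially. norm (?g n) \<le> exp 2 * (t * exp 2) ^ n"
        using le by (intro always_eventually) (simp add: prob_cluster_ge_def)
    qed
    then have "(\<lambda>n. 1 - ?g n) \<longlonglongrightarrow> 1 - 0" by (intro tendsto_intros)
    then have "(\<lambda>n. \<Sum>k<n. prob_cluster_eq \<mu> v (Suc k) t) \<longlonglongrightarrow> 1"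
      by (simp add: prob_cluster_ge_eq)
    then have "(\<lambda>k. complex_of_real (prob_cluster_eq \<mu> v (Suc k) t)) sums of_real 1"
      unfolding sums_of_real_iff by (simp add: sums_def)
    moreover have "P k (of_real t) = of_real (prob_cluster_eq \<mu> v (Suc k) t)" for k
      using entire_extension_cluster_series[of "Suc k" v] t by (simp add: entire_extension_def P_def)
    ultimately show ?thesis unfolding F_def by (simp add: sums_iff)
  qed
  \<comment> \<open>The identity \<open>F = 1\<close> spreads from the interval
    \<open>(0, \<delta>)\<close> to the disc, and in particular to negative times.\<close>
  have "F z - 1 = 0"
  proof (rule analytic_continuation[of "\<lambda>w. F w - 1" "ball 0 \<rho>" "of_real ` {0<..<\<delta>}" 0])
    show "(\<lambda>w. F w - 1) holomorphic_on ball 0 \<rho>" by (intro holomorphic_intros holF)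
  qed (use F1 \<rho> \<delta> zero_islimpt_of_real_interval in auto)
  then show ?thesis using sumP[of z] \<rho> unfolding F_def P_def by (simp add: sums_iff)
qed

lemma decay_of_tendsto_zero:
  fixes r r' :: real
  assumes "r < r'" "r' < 0" "(\<lambda>m. cluster_series v m (of_real r)) \<longlonglongrightarrow> 0"
  obtains C q where "0 < q" "q < 1"
    and "\<And>n. norm (cluster_series v (Suc n) (of_real r')) \<le> C * q ^ n"
    and "\<And>n. norm (1 - (\<Sum>k<n. cluster_series v (Suc k) (of_real r'))) \<le> C * q ^ n"
proof -
  \<comment> \<open>The comparison is made with \<open>s = - r\<close>, so the gain per step is
    \<open>norm r' / s = r' / r\<close>.\<close>
  define q where "q = r' / r"
  have q: "0 < q" "q < 1" using assms by (auto simp: q_def divide_simps)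
  obtain C where C: "norm (cluster_series v m (of_real r)) \<le> C" for m
    using convergent_imp_Bseq[of "\<lambda>m. cluster_series v m (of_real r)"] assms(3)
    unfolding Bseq_def convergent_def by blast
  have C0: "C \<ge> 0" using order_trans[OF norm_ge_zero C] .
  let ?P = "\<lambda>k. cluster_series v (Suc k) (complex_of_real r')"
  have P: "norm (?P n) \<le> C * q ^ n" for n
  proof -
    have "norm (?P n) \<le> (norm (complex_of_real r') / - r) ^ n * norm (cluster_series v (Suc n) (of_real (- (- r))))"
      using norm_cluster_series_le[of "Suc n" "of_real r'" "- r" v] assms by simp
    also have "norm (complex_of_real r') / - r = q" using assms by (simp add: q_def)
    also have "q ^ n * norm (cluster_series v (Suc n) (of_real (- (- r)))) \<le> q ^ n * C"
      using q C by (intro mult_left_mono) auto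
    finally show ?thesis by (simp add: mult.commute)
  qed
  have sums: "?P sums 1"
    using sum_cluster_series_eq_one[of "- r" "of_real r'" v] assms by simp
  have F: "norm (1 - (\<Sum>k<n. ?P k)) \<le> C / (1 - q) * q ^ n" for n
  proof -
    have geo: "(\<lambda>k. C * q ^ n * q ^ k) sums (C * q ^ n * (1 / (1 - q)))"
      using q by (intro sums_mult geometric_sums) auto
    \<comment> \<open>As the whole series sums to one, one minus a partial sum is a tail and
      inherits the geometric decay.\<close>
    have "(\<lambda>k. ?P (k + n)) sums (1 - (\<Sum>k<n. ?P k))"
      using sums by (rule sums_split_initial_segment)
    then have "1 - (\<Sum>k<n. ?P k) = (\<Sum>k. ?P (k + n))" by (rule sums_unique)
    also have "norm \<dots> \<le> (\<Sum>k. C * q ^ n * q ^ k)"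
      using P[of "_ + n"] geo by (intro norm_suminf_le) (auto simp: power_add mult_ac sums_iff)
    also have "\<dots> = C / (1 - q) * q ^ n" using sums_unique[OF geo] by simp
    finally show ?thesis .
  qed
  \<comment> \<open>The larger constant \<open>C / (1 - q)\<close> serves both estimates.\<close>
  have "C \<le> C / (1 - q)" using q C0 by (simp add: divide_simps mult_left_le)
  then have "C * q ^ n \<le> C / (1 - q) * q ^ n" for n using q by (intro mult_right_mono) auto
  then show ?thesis using that[OF q, of "C / (1 - q)"] F P order_trans by meson
qed

end

section \<open>Sequence estimates and comparison of the five thresholds\<close>

lemma summable_on_atLeast_1:
  fixes g :: "nat \<Rightarrow> real"
  assumes "\<And>m. g m \<ge> 0" "summable (\<lambda>n. g (Suc n))"
  shows "g summable_on {1..}"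
proof -
  have "summable g" using assms(2) by (simp add: summable_Suc_iff)
  then have "g summable_on UNIV" using assms(1) by (intro norm_summable_imp_summable_on) simp
  then show ?thesis by (rule summable_on_subset_banach) simp
qed

lemma tendsto_zero_of_summable_on:
  fixes g :: "nat \<Rightarrow> real"
  assumes "g summable_on {1..}" "\<And>m. g m \<ge> 0"
  shows "g \<longlonglongrightarrow> 0"
proof -
  have "g summable_on (insert 0 {1..})" using assms(1) by (simp only: summable_on_insert_iff)
  moreover have "insert 0 {1..} = (UNIV :: nat set)" by auto
  ultimately have "g summable_on UNIV" by simp
  then show ?thesis using summable_on_imp_summable summable_LIMSEQ_zero by blast
qed

text \<open>A slightly larger base \<open>c\<close> eventually absorbs both the constant
  \<open>C\<close> and the shift of the index.\<close>

lemma eventually_geometric_le: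
  fixes q c C :: real
  assumes "0 < q" "q < c"
  shows "\<forall>\<^sub>F n in sequentially. C * q ^ n \<le> c ^ Suc n"
proof -
  have c: "c > 0" using assms by linarith
  have "(\<lambda>n. C / c * (q / c) ^ n) \<longlonglongrightarrow> C / c * 0"
    using assms c by (intro tendsto_intros LIMSEQ_realpow_zero) auto
  then have "\<forall>\<^sub>F n in sequentially. C / c * (q / c) ^ n < 1"
    by (intro order_tendstoD(2)) auto
  then show ?thesis
  proof eventually_elim
    case (elim n)
    have "C * q ^ n = c ^ Suc n * (C / c * (q / c) ^ n)" using c by (simp add: power_divide)
    also have "\<dots> \<le> c ^ Suc n * 1" using c elim by (intro mult_left_mono) auto
    finally show ?case by simp
  qed
qed

lemma tendsto_zero_of_eventually_le_power:
  fixes g :: "nat \<Rightarrow> 'b::real_normed_vector" and c :: real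
  assumes "c < 1" "\<forall>\<^sub>F m in sequentially. norm (g m) \<le> c ^ m"
  shows "g \<longlonglongrightarrow> 0"
proof -
  obtain N where N: "\<And>m. m \<ge> N \<Longrightarrow> norm (g m) \<le> c ^ m"
    using assms(2) by (auto simp: eventually_sequentially)
  \<comment> \<open>An odd power of a negative \<open>c\<close> cannot bound a norm.\<close>
  have "0 \<le> c ^ (2 * N + 1)" using order_trans[OF norm_ge_zero N[of "2 * N + 1"]] by simp
  then have "0 \<le> c" by (subst (asm) zero_le_odd_power) auto
  then have "(\<lambda>m. c ^ m) \<longlonglongrightarrow> 0" using assms(1) by (intro LIMSEQ_power_zero) auto
  then show ?thesis using assms(2) by (rule Lim_null_comparison[rotated])
qed

theorem theorem13p3:
  fixes \<mu> :: "'v uprod \<Rightarrow> real"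
    and G :: "('g, 'c) monoid_scheme"
    and \<phi> :: "'g \<Rightarrow> 'v \<Rightarrow> 'v"
    and v :: 'v
    and p f :: "nat \<Rightarrow> complex \<Rightarrow> complex"
    and t1 t2 t3 t4 t5 :: ereal
  assumes model: "transitive_long_range_model \<mu> G \<phi>"
    and p: "\<And>m. m \<ge> 1 \<Longrightarrow> entire_extension (p m) (prob_cluster_eq \<mu> v m)"
    and f: "\<And>m. m \<ge> 1 \<Longrightarrow> entire_extension (f m) (prob_cluster_ge \<mu> v m)"
    and t1: "t1 = Inf (ereal ` {r. r < 0 \<and> (\<lambda>m. p m (of_real r)) \<longlonglongrightarrow> 0})"
    and t2: "t2 = Inf (ereal ` {r. r < 0 \<and>
               (\<lambda>m. real m * norm (p m (of_real r))) summable_on {1..}})"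
    and t3: "t3 = Inf (ereal ` {r. r < 0 \<and> (\<lambda>m. f m (of_real r)) \<longlonglongrightarrow> 0})"
    and t4: "t4 = Inf (ereal ` {r. r < 0 \<and>
               (\<lambda>m. norm (f m (of_real r))) summable_on {1..}})"
    and t5: "t5 = Inf (ereal ` {r. r < 0 \<and>
               (\<exists>c<1. \<forall>\<^sub>F m in sequentially. norm (p m (of_real r)) \<le> c ^ m)})"
  shows "t1 = t2 \<and> t2 = t3 \<and> t3 = t4 \<and> t4 = t5"
proof -
  interpret transitive_long_range_model \<mu> G \<phi> by (rule model)
  let ?P = "cluster_series v"
  let ?A1 = "{r. r < 0 \<and> (\<lambda>m. p m (of_real r)) \<longlonglongrightarrow> 0}"
  let ?A2 = "{r. r < 0 \<and> (\<lambda>m. real m * norm (p m (of_real r))) summable_on {1..}}"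
  let ?A3 = "{r. r < 0 \<and> (\<lambda>m. f m (of_real r)) \<longlonglongrightarrow> 0}"
  let ?A4 = "{r. r < 0 \<and> (\<lambda>m. norm (f m (of_real r))) summable_on {1..}}"
  let ?A5 = "{r. r < 0 \<and> (\<exists>c<1. \<forall>\<^sub>F m in sequentially. norm (p m (of_real r)) \<le> c ^ m)}"
  \<comment> \<open>By uniqueness of extensions, \<open>p\<close> and \<open>f\<close> become
    explicit series. The hypotheses start at \<open>m = 1\<close> and leave \<open>p 0\<close> and
    \<open>f 0\<close> arbitrary, so everything is stated at \<open>Suc n\<close>.\<close>
  have pP: "p (Suc n) = ?P (Suc n)" for n
    by (rule entire_extension_unique[OF p entire_extension_cluster_series]) auto
  have fP: "f (Suc n) = (\<lambda>z. 1 - (\<Sum>k<n. ?P (Suc k) z))" for n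
  proof (rule entire_extension_unique[OF f])
    show "entire_extension (\<lambda>z. 1 - (\<Sum>k<n. ?P (Suc k) z)) (prob_cluster_ge \<mu> v (Suc n))"
      using entire_extension_cluster_series[of "Suc _" v]
      by (auto simp: entire_extension_def prob_cluster_ge_eq intro!: holomorphic_intros)
  qed simp
  have decay: "\<exists>C q. 0 < q \<and> q < 1 \<and> (\<forall>n. norm (p (Suc n) (of_real r')) \<le> C * q ^ n) \<and>
      (\<forall>n. norm (f (Suc n) (of_real r')) \<le> C * q ^ n)"
    if r: "r \<in> ?A1" "r < r'" "r' < 0" for r r'
  proof -
    have "(\<lambda>n. ?P (Suc n) (of_real r)) \<longlonglongrightarrow> 0"
      unfolding pP[symmetric] using r by (intro LIMSEQ_Suc) auto
    then have "(\<lambda>m. ?P m (of_real r)) \<longlonglongrightarrow> 0" by (rule LIMSEQ_imp_Suc)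
    then obtain C q where "0 < q" "q < 1"
      "\<And>n. norm (?P (Suc n) (of_real r')) \<le> C * q ^ n"
      "\<And>n. norm (1 - (\<Sum>k<n. ?P (Suc k) (of_real r'))) \<le> C * q ^ n"
      using decay_of_tendsto_zero[OF r(2,3)] by metis
    then show ?thesis unfolding pP fP by (intro exI[of _ C] exI[of _ q]) simp
  qed
  \<comment> \<open>The set \<open>?A1\<close> is the largest of the five: each of the other
    conditions at \<open>r\<close> forces \<open>p m\<close> to tend to zero at
    \<open>r\<close>.\<close>
  have A2: "?A2 \<subseteq> ?A1"
  proof
    fix r assume r: "r \<in> ?A2"
    then have "(\<lambda>m. real m * norm (p m (of_real r))) \<longlonglongrightarrow> 0"
      by (intro tendsto_zero_of_summable_on) auto
    moreover have "\<forall>\<^sub>F m in sequentially. norm (p m (of_real r)) \<le> real m * norm (p m (of_real r))"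
      using eventually_ge_at_top[of 1]
    proof eventually_elim
      case (elim m)
      then have "1 * norm (p m (of_real r)) \<le> real m * norm (p m (of_real r))"
        by (intro mult_right_mono) auto
      then show ?case by simp
    qed
    ultimately show "r \<in> ?A1" using r by (auto intro: Lim_null_comparison)
  qed
  have A3: "?A3 \<subseteq> ?A1"
  proof
    fix r assume r: "r \<in> ?A3"
    then have "(\<lambda>n. f (Suc n) (of_real r) - f (Suc (Suc n)) (of_real r)) \<longlonglongrightarrow> 0 - 0"
      by (intro tendsto_diff LIMSEQ_Suc) auto
    \<comment> \<open>Consecutive tails differ by one term of the series, so decay of
      \<open>f\<close> passes to \<open>p\<close>.\<close>
    moreover have "f (Suc n) z - f (Suc (Suc n)) z = p (Suc n) z" for n z by (simp add: fP pP)
    ultimately have "(\<lambda>n. p (Suc n) (of_real r)) \<longlonglongrightarrow> 0" by simp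
    then have "(\<lambda>m. p m (of_real r)) \<longlonglongrightarrow> 0" by (rule LIMSEQ_imp_Suc)
    then show "r \<in> ?A1" using r by simp
  qed
  have "?A4 \<subseteq> ?A3"
  proof
    fix r assume r: "r \<in> ?A4"
    then have "(\<lambda>m. norm (f m (of_real r))) \<longlonglongrightarrow> 0" by (intro tendsto_zero_of_summable_on) auto
    then show "r \<in> ?A3" using r by (auto simp: tendsto_norm_zero_iff)
  qed
  then have A4: "?A4 \<subseteq> ?A1" using A3 by (rule subset_trans)
  have A5: "?A5 \<subseteq> ?A1"
  proof
    fix r assume r: "r \<in> ?A5"
    then obtain c where "c < 1" "\<forall>\<^sub>F m in sequentially. norm (p m (of_real r)) \<le> c ^ m" by blast
    then have "(\<lambda>m. p m (of_real r)) \<longlonglongrightarrow> 0" by (rule tendsto_zero_of_eventually_le_power)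
    then show "r \<in> ?A1" using r by simp
  qed
  \<comment> \<open>Conversely, the weakest condition at \<open>r\<close> yields all the others at
    every \<open>r'\<close> between \<open>r\<close> and \<open>0\<close>.\<close>
  have in_all: "r' \<in> ?A2 \<and> r' \<in> ?A3 \<and> r' \<in> ?A4 \<and> r' \<in> ?A5" if r: "r \<in> ?A1" "r < r'" "r' < 0" for r r'
  proof -
    obtain C q where q: "0 < q" "q < 1" and P: "\<And>n. norm (p (Suc n) (of_real r')) \<le> C * q ^ n"
      and F: "\<And>n. norm (f (Suc n) (of_real r')) \<le> C * q ^ n"
      using decay[OF r] by blast
    have geo: "summable (\<lambda>n. C * q ^ n)" using q by (intro summable_mult summable_geometric) auto
    \<comment> \<open>The weight \<open>m\<close> is handled by the differentiated geometric
      series.\<close>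
    have dgeo: "summable (\<lambda>n. C * (real (Suc n) * q ^ n))"
      using geometric_deriv_sums[of q] q by (intro summable_mult) (auto simp: sums_iff)
    have "summable (\<lambda>n. real (Suc n) * norm (p (Suc n) (of_real r')))"
    proof (rule summable_comparison_test'[OF dgeo])
      show "norm (real (Suc n) * norm (p (Suc n) (of_real r'))) \<le> C * (real (Suc n) * q ^ n)" for n
        using mult_left_mono[OF P[of n], of "real (Suc n)"] by (simp add: mult_ac)
    qed
    then have 2: "r' \<in> ?A2" using r(3) summable_on_atLeast_1[of "\<lambda>m. real m * norm (p m (of_real r'))"] by simp
    have "summable (\<lambda>n. norm (f (Suc n) (of_real r')))"
      using F by (intro summable_comparison_test'[OF geo, of 0]) auto
    then have 4: "r' \<in> ?A4" using r(3) summable_on_atLeast_1[of "\<lambda>m. norm (f m (of_real r'))"] by simp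
    then have 3: "r' \<in> ?A3" using \<open>?A4 \<subseteq> ?A3\<close> by blast
    obtain c where c: "q < c" "c < 1" using dense[OF q(2)] by blast
    have "\<forall>\<^sub>F n in sequentially. norm (p (Suc n) (of_real r')) \<le> c ^ Suc n"
      using eventually_geometric_le[OF q(1) c(1), of C] by eventually_elim (rule order_trans[OF P])
    then have "\<forall>\<^sub>F m in sequentially. norm (p m (of_real r')) \<le> c ^ m"
      by (rule eventually_sequentially_Suc[THEN iffD1])
    then have 5: "r' \<in> ?A5" using r(3) c(2) by blast
    show ?thesis using 2 3 4 5 by (intro conjI)
  qed
  have eq: "Inf (ereal ` A) = Inf (ereal ` ?A1)"
    if "A \<subseteq> ?A1" "\<And>r r'. r \<in> ?A1 \<Longrightarrow> r < r' \<Longrightarrow> r' < 0 \<Longrightarrow> r' \<in> A" for A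
    by (rule Inf_ereal_eqI[OF that]) auto
  have "Inf (ereal ` ?A2) = Inf (ereal ` ?A1)"
    by (rule eq[OF A2]) (drule (2) in_all; elim conjE; assumption)
  moreover have "Inf (ereal ` ?A3) = Inf (ereal ` ?A1)"
    by (rule eq[OF A3]) (drule (2) in_all; elim conjE; assumption)
  moreover have "Inf (ereal ` ?A4) = Inf (ereal ` ?A1)"
    by (rule eq[OF A4]) (drule (2) in_all; elim conjE; assumption)
  moreover have "Inf (ereal ` ?A5) = Inf (ereal ` ?A1)"
    by (rule eq[OF A5]) (drule (2) in_all; elim conjE; assumption)
  ultimately show ?thesis unfolding t1 t2 t3 t4 t5 by simp
qed

end
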